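(* Let $F:(M,g_M,J)\to(B,g_B)$ be a generic Riemannian submersion from a nearly Kaehler manifold onto a Riemannian manifold. Then the distribution $\mathcal{D}^\perp$ is integrable if and only if $$\mathcal{V}\nabla_{U}\phi V-\mathcal{V}\nabla_{V}\phi U+\mathcal{T}_{U}\omega V-\mathcal{T}_{V}\omega U-2\mathcal{Q}_{U}V\in\Gamma(\mathcal{D}^\perp)$$ for any $U,V\in\Gamma(\mathcal{D}^\perp)$.
   Context: An almost Hermitian manifold $(M,g_M,J)$ is a Riemannian manifold with an almost complex structure $J$ such that $J^2=-I$ and $g_M(JX,JY)=g_M(X,Y)$; $\nabla$ is the Levi-Civita connection of $g_M$. It is nearly Kaehler if $(\nabla_XJ)Y+(\nabla_YJ)X=0$ for all $X,Y$. A Riemannian submersion $F:(M,g_M)\to(B,g_B)$ (with $\dim M>\dim B$) is a smooth map of maximal rank whose differential $F_*$ preserves the scalar product of vectors normal to the fibers. $\ker F_*$ is the vertical distribution, its orthogonal complement $(\ker F_* )^\perp$ the horizontal distribution; $\mathcal{V},\mathcal{H}$ denote the orthogonal projections of $TM$ onto them. $F$ is a generic Riemannian submersion if there is a distribution $\mathcal{D}\subset\ker F_*$ with $\ker F_*=\mathcal{D}\oplus\mathcal{D}^\perp$ and $J\mathcal{D}=\mathcal{D}$, where $\mathcal{D}^\perp$ is the orthogonal complement of $\mathcal{D}$ in $\ker F_*$ and is purely real, i.e. $\mathcal{D}^\perp\cap J\mathcal{D}^\perp=\{0\}$. For vertical $U$ write $JU=\phi U+\omega U$ with $\phi U$ vertical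 and $\omega U$ horizontal. O'Neill's tensor: $\mathcal{T}_{E}G=\mathcal{H}\nabla_{\mathcal{V}E}\mathcal{V}G+\mathcal{V}\nabla_{\mathcal{V}E}\mathcal{H}G$ for vector fields $E,G$ on $M$. $\mathcal{Q}_{E}G$ denotes the vertical part of $(\nabla_EJ)G$. *)

theory Defs
  imports "HOL-Analysis.Analysis"
begin

section \<open>Smooth functions between Euclidean spaces\<close>

primrec Ck_on :: "nat \<Rightarrow> 'a::euclidean_space set \<Rightarrow> ('a \<Rightarrow> 'b::euclidean_space) \<Rightarrow> bool" where
  "Ck_on 0 S f \<longleftrightarrow> continuous_on S f"
| "Ck_on (Suc k) S f \<longleftrightarrow>
     (\<forall>x\<in>S. f differentiable (at x)) \<and>
     (\<forall>v. Ck_on k S (\<lambda>x. frechet_derivative f (at x) v))"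

text \<open>Only used for open \<open>S\<close>; the values of \<open>f\<close> outside \<open>S\<close> are then irrelevant.\<close>

definition smooth_on :: "'a::euclidean_space set \<Rightarrow> ('a \<Rightarrow> 'b::euclidean_space) \<Rightarrow> bool" where
  "smooth_on S f \<longleftrightarrow> (\<forall>k. Ck_on k S f)"


section \<open>Smooth manifolds\<close>

text \<open>
  The underlying space of a manifold is a whole (Hausdorff, second countable) type \<open>'m\<close>; its
  dimension is the dimension of the model space \<open>'e\<close>. The smooth structure is given by an atlas,
  i.e. a set of charts \<open>(U, x)\<close>, where the values of \<open>x\<close> outside \<open>U\<close> are irrelevant.
\<close>

type_synonym ('m, 'e) chart = "'m set \<times> ('m \<Rightarrow> 'e)"

abbreviation chart_dom :: "('m, 'e) chart \<Rightarrow> 'm set" where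
  "chart_dom c \<equiv> fst c"

abbreviation chart_map :: "('m, 'e) chart \<Rightarrow> 'm \<Rightarrow> 'e" where
  "chart_map c \<equiv> snd c"

definition chart_inv :: "('m, 'e) chart \<Rightarrow> 'e \<Rightarrow> 'm" where
  "chart_inv c = inv_into (chart_dom c) (chart_map c)"

definition smooth_manifold ::
    "('m::{t2_space,second_countable_topology}, 'e::euclidean_space) chart set \<Rightarrow> bool" where
  "smooth_manifold M \<longleftrightarrow>
     (\<Union>c\<in>M. chart_dom c) = UNIV \<and>
     (\<forall>c\<in>M. open (chart_dom c) \<and> open (chart_map c ` chart_dom c) \<and>
        homeomorphism (chart_dom c) (chart_map c ` chart_dom c) (chart_map c) (chart_inv c)) \<and>
     (\<forall>c\<in>M. \<forall>d\<in>M.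
        smooth_on (chart_map c ` (chart_dom c \<inter> chart_dom d)) (chart_map d \<circ> chart_inv c))"

definition smooth_function :: "('m, 'e::euclidean_space) chart set \<Rightarrow> ('m \<Rightarrow> real) \<Rightarrow> bool" where
  "smooth_function M f \<longleftrightarrow>
     (\<forall>c\<in>M. smooth_on (chart_map c ` chart_dom c) (f \<circ> chart_inv c))"

definition smooth_map ::
    "('m::topological_space, 'e::euclidean_space) chart set \<Rightarrow>
     ('b::topological_space, 'f::euclidean_space) chart set \<Rightarrow> ('m \<Rightarrow> 'b) \<Rightarrow> bool" where
  "smooth_map M B F \<longleftrightarrow> continuous_on UNIV F \<and>
     (\<forall>c\<in>M. \<forall>d\<in>B. smooth_on (chart_map c ` (chart_dom c \<inter> F -` chart_dom d))
        (chart_map d \<circ> F \<circ> chart_inv c))"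


section \<open>Tangent vectors and vector fields\<close>

text \<open>
  The tangent space at \<open>p\<close> is modelled by the space \<open>'e\<close> itself: a vector \<open>v :: 'e\<close> at \<open>p\<close>
  stands for the tangent vector whose components in one chart \<open>chart_at M p\<close>, selected once
  and for all at each point, are \<open>v\<close>. The selected charts at neighbouring points are unrelated, so
  smoothness of a vector field is \<^emph>\<open>not\<close> smoothness of it as an \<open>'e\<close>-valued function: the
  components have to be converted to a common chart first, which is the role of
  \<open>to_coords\<close>. Its inverse is \<open>from_coords\<close>.
\<close>

definition chart_at :: "('m, 'e) chart set \<Rightarrow> 'm \<Rightarrow> ('m, 'e) chart" where
  "chart_at M p = (SOME c. c \<in> M \<and> p \<in> chart_dom c)"

definition to_coords ::
    "('m, 'e::euclidean_space) chart set \<Rightarrow> ('m, 'e) chart \<Rightarrow> 'm \<Rightarrow> 'e \<Rightarrow> 'e" where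
  "to_coords M c p v =
     frechet_derivative (chart_map c \<circ> chart_inv (chart_at M p))
       (at (chart_map (chart_at M p) p)) v"

definition from_coords ::
    "('m, 'e::euclidean_space) chart set \<Rightarrow> ('m, 'e) chart \<Rightarrow> 'm \<Rightarrow> 'e \<Rightarrow> 'e" where
  "from_coords M c p a =
     frechet_derivative (chart_map (chart_at M p) \<circ> chart_inv c) (at (chart_map c p)) a"

definition field_in_chart ::
    "('m, 'e::euclidean_space) chart set \<Rightarrow> ('m, 'e) chart \<Rightarrow> ('m \<Rightarrow> 'e) \<Rightarrow> 'e \<Rightarrow> 'e" where
  "field_in_chart M c X x = to_coords M c (chart_inv c x) (X (chart_inv c x))"

definition smooth_field_on ::
    "('m, 'e::euclidean_space) chart set \<Rightarrow> 'm set \<Rightarrow> ('m \<Rightarrow> 'e) \<Rightarrow> bool" where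
  "smooth_field_on M W X \<longleftrightarrow>
     (\<forall>c\<in>M. smooth_on (chart_map c ` (chart_dom c \<inter> W)) (field_in_chart M c X))"

definition vector_fields :: "('m, 'e::euclidean_space) chart set \<Rightarrow> ('m \<Rightarrow> 'e) set" where
  "vector_fields M = {X. smooth_field_on M UNIV X}"

definition directional_derivative ::
    "('m, 'e::euclidean_space) chart set \<Rightarrow> ('m \<Rightarrow> 'e) \<Rightarrow> ('m \<Rightarrow> real) \<Rightarrow> 'm \<Rightarrow> real" where
  "directional_derivative M X f p =
     frechet_derivative (f \<circ> chart_inv (chart_at M p)) (at (chart_map (chart_at M p) p)) (X p)"

definition pushforward ::
    "('m, 'e::euclidean_space) chart set \<Rightarrow> ('b, 'f::euclidean_space) chart set \<Rightarrow>
     ('m \<Rightarrow> 'b) \<Rightarrow> 'm \<Rightarrow> 'e \<Rightarrow> 'f" where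
  "pushforward M B F p v =
     frechet_derivative (chart_map (chart_at B (F p)) \<circ> F \<circ> chart_inv (chart_at M p))
       (at (chart_map (chart_at M p) p)) v"

text \<open>
  \<open>[X, Y]\<^sup>i = X\<^sup>j \<partial>\<^sub>j Y\<^sup>i - Y\<^sup>j \<partial>\<^sub>j X\<^sup>i\<close>, evaluated at \<open>p\<close> in the chart selected at \<open>p\<close>, so that
  \<open>[X, Y] f = X (Y f) - Y (X f)\<close>.
\<close>

definition lie_bracket ::
    "('m, 'e::euclidean_space) chart set \<Rightarrow> ('m \<Rightarrow> 'e) \<Rightarrow> ('m \<Rightarrow> 'e) \<Rightarrow> 'm \<Rightarrow> 'e" where
  "lie_bracket M X Y p =
     (let c = chart_at M p; x = chart_map c p in
        frechet_derivative (field_in_chart M c Y) (at x) (X p) -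
        frechet_derivative (field_in_chart M c X) (at x) (Y p))"


section \<open>Distributions\<close>

definition distribution ::
    "('m::topological_space, 'e::euclidean_space) chart set \<Rightarrow> ('m \<Rightarrow> 'e set) \<Rightarrow> bool" where
  "distribution M D \<longleftrightarrow>
     (\<exists>r. \<forall>p. subspace (D p) \<and> dim (D p) = r \<and>
        (\<exists>W X. open W \<and> p \<in> W \<and> (\<forall>i<r. smooth_field_on M W (X i)) \<and>
           (\<forall>q\<in>W. span ((\<lambda>i::nat. X i q) ` {..<r}) = D q)))"

definition sections ::
    "('m, 'e::euclidean_space) chart set \<Rightarrow> ('m \<Rightarrow> 'e set) \<Rightarrow> ('m \<Rightarrow> 'e) set" where
  "sections M D = {X \<in> vector_fields M. \<forall>p. X p \<in> D p}"

text \<open>Integrability of a distribution means closure of its sections under the Lie bracket.\<close>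

definition integrable_distribution ::
    "('m, 'e::euclidean_space) chart set \<Rightarrow> ('m \<Rightarrow> 'e set) \<Rightarrow> bool" where
  "integrable_distribution M D \<longleftrightarrow>
     (\<forall>X\<in>sections M D. \<forall>Y\<in>sections M D. lie_bracket M X Y \<in> sections M D)"


section \<open>Riemannian and almost Hermitian manifolds\<close>

definition riemannian_metric ::
    "('m, 'e::euclidean_space) chart set \<Rightarrow> ('m \<Rightarrow> 'e \<Rightarrow> 'e \<Rightarrow> real) \<Rightarrow> bool" where
  "riemannian_metric M g \<longleftrightarrow>
     (\<forall>p. bilinear (g p) \<and> (\<forall>v w. g p v w = g p w v) \<and> (\<forall>v. v \<noteq> 0 \<longrightarrow> g p v v > 0)) \<and>
     (\<forall>c\<in>M. \<forall>a b. smooth_on (chart_map c ` chart_dom c)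
        (\<lambda>x. let p = chart_inv c x in g p (from_coords M c p a) (from_coords M c p b)))"

definition riemannian_manifold ::
    "('m::{t2_space,second_countable_topology}, 'e::euclidean_space) chart set \<Rightarrow>
     ('m \<Rightarrow> 'e \<Rightarrow> 'e \<Rightarrow> real) \<Rightarrow> bool" where
  "riemannian_manifold M g \<longleftrightarrow> smooth_manifold M \<and> riemannian_metric M g"

definition almost_complex_structure ::
    "('m, 'e::euclidean_space) chart set \<Rightarrow> ('m \<Rightarrow> 'e \<Rightarrow> 'e) \<Rightarrow> bool" where
  "almost_complex_structure M J \<longleftrightarrow>
     (\<forall>p. linear (J p) \<and> (\<forall>v. J p (J p v) = - v)) \<and>
     (\<forall>c\<in>M. \<forall>a. smooth_on (chart_map c ` chart_dom c)
        (\<lambda>x. let p = chart_inv c x in to_coords M c p (J p (from_coords M c p a))))"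

definition almost_hermitian_manifold ::
    "('m::{t2_space,second_countable_topology}, 'e::euclidean_space) chart set \<Rightarrow>
     ('m \<Rightarrow> 'e \<Rightarrow> 'e \<Rightarrow> real) \<Rightarrow> ('m \<Rightarrow> 'e \<Rightarrow> 'e) \<Rightarrow> bool" where
  "almost_hermitian_manifold M g J \<longleftrightarrow>
     riemannian_manifold M g \<and> almost_complex_structure M J \<and>
     (\<forall>p v w. g p (J p v) (J p w) = g p v w)"


section \<open>The Levi-Civita connection\<close>

text \<open>
  Connections act on smooth vector fields; nothing is required of their values on other
  arguments.
\<close>

definition affine_connection ::
    "('m, 'e::euclidean_space) chart set \<Rightarrow> (('m \<Rightarrow> 'e) \<Rightarrow> ('m \<Rightarrow> 'e) \<Rightarrow> 'm \<Rightarrow> 'e) \<Rightarrow> bool" where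
  "affine_connection M nab \<longleftrightarrow>
     (\<forall>X\<in>vector_fields M. \<forall>Y\<in>vector_fields M. nab X Y \<in> vector_fields M) \<and>
     (\<forall>X\<in>vector_fields M. \<forall>Y\<in>vector_fields M. \<forall>Z\<in>vector_fields M. \<forall>p.
        nab (\<lambda>q. X q + Y q) Z p = nab X Z p + nab Y Z p \<and>
        nab X (\<lambda>q. Y q + Z q) p = nab X Y p + nab X Z p) \<and>
     (\<forall>f. smooth_function M f \<longrightarrow> (\<forall>X\<in>vector_fields M. \<forall>Y\<in>vector_fields M. \<forall>p.
        nab (\<lambda>q. f q *\<^sub>R X q) Y p = f p *\<^sub>R nab X Y p \<and>
        nab X (\<lambda>q. f q *\<^sub>R Y q) p = directional_derivative M X f p *\<^sub>R Y p + f p *\<^sub>R nab X Y p))"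

definition levi_civita_connection ::
    "('m, 'e::euclidean_space) chart set \<Rightarrow> ('m \<Rightarrow> 'e \<Rightarrow> 'e \<Rightarrow> real) \<Rightarrow>
     (('m \<Rightarrow> 'e) \<Rightarrow> ('m \<Rightarrow> 'e) \<Rightarrow> 'm \<Rightarrow> 'e) \<Rightarrow> bool" where
  "levi_civita_connection M g nab \<longleftrightarrow>
     affine_connection M nab \<and>
     (\<forall>X\<in>vector_fields M. \<forall>Y\<in>vector_fields M. \<forall>p.
        nab X Y p - nab Y X p = lie_bracket M X Y p) \<and>
     (\<forall>X\<in>vector_fields M. \<forall>Y\<in>vector_fields M. \<forall>Z\<in>vector_fields M. \<forall>p.
        directional_derivative M X (\<lambda>q. g q (Y q) (Z q)) p =
        g p (nab X Y p) (Z p) + g p (Y p) (nab X Z p))"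

definition nabla_J ::
    "(('m \<Rightarrow> 'e) \<Rightarrow> ('m \<Rightarrow> 'e) \<Rightarrow> 'm \<Rightarrow> 'e::euclidean_space) \<Rightarrow> ('m \<Rightarrow> 'e \<Rightarrow> 'e) \<Rightarrow>
     ('m \<Rightarrow> 'e) \<Rightarrow> ('m \<Rightarrow> 'e) \<Rightarrow> 'm \<Rightarrow> 'e" where
  "nabla_J nab J X Y p = nab X (\<lambda>q. J q (Y q)) p - J p (nab X Y p)"

definition nearly_kaehler ::
    "('m::{t2_space,second_countable_topology}, 'e::euclidean_space) chart set \<Rightarrow>
     ('m \<Rightarrow> 'e \<Rightarrow> 'e \<Rightarrow> real) \<Rightarrow> ('m \<Rightarrow> 'e \<Rightarrow> 'e) \<Rightarrow>
     (('m \<Rightarrow> 'e) \<Rightarrow> ('m \<Rightarrow> 'e) \<Rightarrow> 'm \<Rightarrow> 'e) \<Rightarrow> bool" where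
  "nearly_kaehler M g J nab \<longleftrightarrow>
     almost_hermitian_manifold M g J \<and> levi_civita_connection M g nab \<and>
     (\<forall>X\<in>vector_fields M. \<forall>Y\<in>vector_fields M. \<forall>p.
        nabla_J nab J X Y p + nabla_J nab J Y X p = 0)"


section \<open>Riemannian submersions\<close>

definition vertical ::
    "('m, 'e::euclidean_space) chart set \<Rightarrow> ('b, 'f::euclidean_space) chart set \<Rightarrow>
     ('m \<Rightarrow> 'b) \<Rightarrow> 'm \<Rightarrow> 'e set" where
  "vertical M B F p = {v. pushforward M B F p v = 0}"

definition horizontal ::
    "('m, 'e::euclidean_space) chart set \<Rightarrow> ('m \<Rightarrow> 'e \<Rightarrow> 'e \<Rightarrow> real) \<Rightarrow>
     ('b, 'f::euclidean_space) chart set \<Rightarrow> ('m \<Rightarrow> 'b) \<Rightarrow> 'm \<Rightarrow> 'e set" where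
  "horizontal M g B F p = {v. \<forall>u\<in>vertical M B F p. g p v u = 0}"

definition riemannian_submersion ::
    "('m::{t2_space,second_countable_topology}, 'e::euclidean_space) chart set \<Rightarrow>
     ('m \<Rightarrow> 'e \<Rightarrow> 'e \<Rightarrow> real) \<Rightarrow>
     ('b::{t2_space,second_countable_topology}, 'f::euclidean_space) chart set \<Rightarrow>
     ('b \<Rightarrow> 'f \<Rightarrow> 'f \<Rightarrow> real) \<Rightarrow> ('m \<Rightarrow> 'b) \<Rightarrow> bool" where
  "riemannian_submersion M g B h F \<longleftrightarrow>
     riemannian_manifold M g \<and> riemannian_manifold B h \<and> DIM('e) > DIM('f) \<and>
     smooth_map M B F \<and>
     (\<forall>p. dim (range (pushforward M B F p)) = DIM('f)) \<and>
     (\<forall>p. \<forall>v\<in>horizontal M g B F p. \<forall>w\<in>horizontal M g B F p.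
        h (F p) (pushforward M B F p v) (pushforward M B F p w) = g p v w)"

text \<open>\<open>G\<close> is a (positive definite) scalar product, in general not the one of the type \<open>'e\<close>.\<close>

definition orth_proj ::
    "('e \<Rightarrow> 'e \<Rightarrow> real) \<Rightarrow> 'e::euclidean_space set \<Rightarrow> 'e \<Rightarrow> 'e" where
  "orth_proj G S v = (THE w. w \<in> S \<and> (\<forall>u\<in>S. G (v - w) u = 0))"

definition vert ::
    "('m, 'e::euclidean_space) chart set \<Rightarrow> ('m \<Rightarrow> 'e \<Rightarrow> 'e \<Rightarrow> real) \<Rightarrow>
     ('b, 'f::euclidean_space) chart set \<Rightarrow> ('m \<Rightarrow> 'b) \<Rightarrow> ('m \<Rightarrow> 'e) \<Rightarrow> 'm \<Rightarrow> 'e" where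
  "vert M g B F X p = orth_proj (g p) (vertical M B F p) (X p)"

definition horiz ::
    "('m, 'e::euclidean_space) chart set \<Rightarrow> ('m \<Rightarrow> 'e \<Rightarrow> 'e \<Rightarrow> real) \<Rightarrow>
     ('b, 'f::euclidean_space) chart set \<Rightarrow> ('m \<Rightarrow> 'b) \<Rightarrow> ('m \<Rightarrow> 'e) \<Rightarrow> 'm \<Rightarrow> 'e" where
  "horiz M g B F X p = orth_proj (g p) (horizontal M g B F p) (X p)"

definition oneill_T ::
    "('m, 'e::euclidean_space) chart set \<Rightarrow> ('m \<Rightarrow> 'e \<Rightarrow> 'e \<Rightarrow> real) \<Rightarrow>
     ('b, 'f::euclidean_space) chart set \<Rightarrow> ('m \<Rightarrow> 'b) \<Rightarrow>
     (('m \<Rightarrow> 'e) \<Rightarrow> ('m \<Rightarrow> 'e) \<Rightarrow> 'm \<Rightarrow> 'e) \<Rightarrow> ('m \<Rightarrow> 'e) \<Rightarrow> ('m \<Rightarrow> 'e) \<Rightarrow> 'm \<Rightarrow> 'e" where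
  "oneill_T M g B F nab X Y p =
     horiz M g B F (nab (vert M g B F X) (vert M g B F Y)) p +
     vert M g B F (nab (vert M g B F X) (horiz M g B F Y)) p"

definition phi ::
    "('m, 'e::euclidean_space) chart set \<Rightarrow> ('m \<Rightarrow> 'e \<Rightarrow> 'e \<Rightarrow> real) \<Rightarrow> ('m \<Rightarrow> 'e \<Rightarrow> 'e) \<Rightarrow>
     ('b, 'f::euclidean_space) chart set \<Rightarrow> ('m \<Rightarrow> 'b) \<Rightarrow> ('m \<Rightarrow> 'e) \<Rightarrow> 'm \<Rightarrow> 'e" where
  "phi M g J B F U = vert M g B F (\<lambda>p. J p (U p))"

definition omega ::
    "('m, 'e::euclidean_space) chart set \<Rightarrow> ('m \<Rightarrow> 'e \<Rightarrow> 'e \<Rightarrow> real) \<Rightarrow> ('m \<Rightarrow> 'e \<Rightarrow> 'e) \<Rightarrow>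
     ('b, 'f::euclidean_space) chart set \<Rightarrow> ('m \<Rightarrow> 'b) \<Rightarrow> ('m \<Rightarrow> 'e) \<Rightarrow> 'm \<Rightarrow> 'e" where
  "omega M g J B F U = horiz M g B F (\<lambda>p. J p (U p))"

definition Q_tensor ::
    "('m, 'e::euclidean_space) chart set \<Rightarrow> ('m \<Rightarrow> 'e \<Rightarrow> 'e \<Rightarrow> real) \<Rightarrow> ('m \<Rightarrow> 'e \<Rightarrow> 'e) \<Rightarrow>
     ('b, 'f::euclidean_space) chart set \<Rightarrow> ('m \<Rightarrow> 'b) \<Rightarrow>
     (('m \<Rightarrow> 'e) \<Rightarrow> ('m \<Rightarrow> 'e) \<Rightarrow> 'm \<Rightarrow> 'e) \<Rightarrow> ('m \<Rightarrow> 'e) \<Rightarrow> ('m \<Rightarrow> 'e) \<Rightarrow> 'm \<Rightarrow> 'e" where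
  "Q_tensor M g J B F nab X Y = vert M g B F (nabla_J nab J X Y)"


section \<open>Generic Riemannian submersions\<close>

definition vertical_complement ::
    "('m, 'e::euclidean_space) chart set \<Rightarrow> ('m \<Rightarrow> 'e \<Rightarrow> 'e \<Rightarrow> real) \<Rightarrow>
     ('b, 'f::euclidean_space) chart set \<Rightarrow> ('m \<Rightarrow> 'b) \<Rightarrow> ('m \<Rightarrow> 'e set) \<Rightarrow> 'm \<Rightarrow> 'e set" where
  "vertical_complement M g B F D p = {v \<in> vertical M B F p. \<forall>u\<in>D p. g p v u = 0}"

text \<open>
  The distribution \<open>D\<close> whose existence makes a Riemannian submersion generic is a parameter, as
  statements about generic submersions refer to it.
\<close>

definition generic_riemannian_submersion ::
    "('m::{t2_space,second_countable_topology}, 'e::euclidean_space) chart set \<Rightarrow>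
     ('m \<Rightarrow> 'e \<Rightarrow> 'e \<Rightarrow> real) \<Rightarrow> ('m \<Rightarrow> 'e \<Rightarrow> 'e) \<Rightarrow>
     ('b::{t2_space,second_countable_topology}, 'f::euclidean_space) chart set \<Rightarrow>
     ('b \<Rightarrow> 'f \<Rightarrow> 'f \<Rightarrow> real) \<Rightarrow> ('m \<Rightarrow> 'b) \<Rightarrow> ('m \<Rightarrow> 'e set) \<Rightarrow> bool" where
  "generic_riemannian_submersion M g J B h F D \<longleftrightarrow>
     riemannian_submersion M g B h F \<and> distribution M D \<and>
     (\<forall>p. D p \<subseteq> vertical M B F p \<and>
        vertical M B F p = {u + v | u v. u \<in> D p \<and> v \<in> vertical_complement M g B F D p} \<and>
        D p \<inter> vertical_complement M g B F D p = {0} \<and>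
        J p ` D p = D p \<and>
        vertical_complement M g B F D p \<inter> J p ` vertical_complement M g B F D p = {0})"

end

theory Submission
  imports Defs
begin

text \<open>
  Split \<open>J V = \<phi> V + \<omega> V\<close>. As \<open>\<T>\<^sub>U \<omega> V\<close> is the vertical part of \<open>\<nabla>\<^sub>U \<omega> V\<close>, and as the nearly Kaehler
  condition makes \<open>(\<nabla>\<^sub>U J) V\<close> antisymmetric, the field in question is the vertical part of \<open>J [U, V]\<close>,
  that is, \<open>\<phi> [U, V]\<close>, because a bracket of vertical fields is vertical. For a vertical vector
  \<open>W = u + v\<close> with \<open>u \<in> D\<close> and \<open>v \<in> D\<^sup>\<bottom>\<close> one has \<open>\<phi> W = J u + \<phi> v\<close> with \<open>J u \<in> D\<close> and \<open>\<phi> v \<in> D\<^sup>\<bottom>\<close>, so \<open>\<phi> W\<close>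
  is in \<open>D\<^sup>\<bottom>\<close> exactly if \<open>J u = 0\<close>, i.e. if \<open>W \<in> D\<^sup>\<bottom>\<close>. What remains is analytic: the vertical
  projection preserves smoothness of vector fields, which follows by orthogonalising the
  gradients of the components of the submersion in charts.
\<close>

section \<open>Calculus of smooth functions\<close>

lemma Ck_on_Suc_imp: "Ck_on (Suc k) S f \<Longrightarrow> Ck_on k S f"
proof (induction k arbitrary: f)
  case 0
  then show ?case
    by (auto intro!: continuous_at_imp_continuous_on differentiable_imp_continuous_within)
next
  case (Suc k)
  then show ?case by (metis Ck_on.simps(2))
qed

lemma Ck_on_subset: "Ck_on k S f \<Longrightarrow> T \<subseteq> S \<Longrightarrow> Ck_on k T f"
  by (induction k arbitrary: f) (auto intro: continuous_on_subset)

text \<open>On an open set, agreement holds near each point, so the derivatives agree on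
  \<open>S\<close> as well and the induction passes to them.\<close>

lemma Ck_on_cong:
  assumes "open S" "Ck_on k S f" "\<And>x. x \<in> S \<Longrightarrow> f x = g x"
  shows "Ck_on k S g"
  using assms(2,3)
proof (induction k arbitrary: f g)
  case 0
  then show ?case using continuous_on_cong[of S S f g] by simp
next
  case (Suc k)
  have 1: "g differentiable (at x)" if "x \<in> S" for x
  proof -
    from Suc.prems(1) that obtain f' where "(f has_derivative f') (at x)"
      by (auto simp: differentiable_def)
    from has_derivative_transform_within_open[OF this assms(1) that Suc.prems(2)]
    show ?thesis by (auto simp: differentiable_def)
  qed
  have 2: "frechet_derivative f (at x) = frechet_derivative g (at x)" if "x \<in> S" for x
    using Suc.prems that assms(1) by (intro frechet_derivative_transform_within_open) auto
  have "Ck_on k S (\<lambda>x. frechet_derivative g (at x) v)" for v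
    by (rule Suc.IH[of "\<lambda>x. frechet_derivative f (at x) v"]) (use Suc.prems 2 in auto)
  with 1 show ?case by simp
qed

text \<open>Serves for fields that can be described only near each point, as happens when a chart
  domain is not mapped into a single chart of the base.\<close>

lemma Ck_on_local:
  assumes "\<And>x. x \<in> S \<Longrightarrow> \<exists>T. open T \<and> x \<in> T \<and> Ck_on k T f"
  shows "Ck_on k S f"
  using assms
proof (induction k arbitrary: f)
  case 0
  then show ?case
    by (force intro!: continuous_at_imp_continuous_on simp: continuous_on_eq_continuous_at)
next
  case (Suc k)
  have "Ck_on k S (\<lambda>x. frechet_derivative f (at x) v)" for v
    by (rule Suc.IH) (use Suc.prems in \<open>fastforce\<close>)
  moreover have "f differentiable (at x)" if "x \<in> S" for x
    using Suc.prems[OF that] by auto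
  ultimately show ?case by simp
qed

text \<open>Lets any explicit formula for the derivative stand in for
  \<open>frechet_derivative\<close>; uniqueness of derivatives identifies the two on
  \<open>S\<close>.\<close>

lemma Ck_on_SucI:
  assumes "open S" "\<And>x. x \<in> S \<Longrightarrow> (f has_derivative f' x) (at x)"
    and "\<And>v. Ck_on k S (\<lambda>x. f' x v)"
  shows "Ck_on (Suc k) S f"
proof -
  have "Ck_on k S (\<lambda>x. frechet_derivative f (at x) v)" for v
    by (rule Ck_on_cong[OF assms(1) assms(3)[of v]]) (use assms(2) frechet_derivative_at in metis)
  with assms(2) show ?thesis by (auto simp: differentiable_def)
qed

lemma Ck_on_SucD:
  assumes "Ck_on (Suc k) S f" "x \<in> S"
  shows "(f has_derivative frechet_derivative f (at x)) (at x)"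
  using assms by (simp add: frechet_derivative_works[symmetric])

lemma Ck_on_const: "Ck_on k S (\<lambda>x. a)"
  by (induction k arbitrary: a) (auto simp: continuous_on_const)

lemma Ck_on_add:
  assumes "open S" "Ck_on k S f" "Ck_on k S g"
  shows "Ck_on k S (\<lambda>x. f x + g x)"
  using assms(2,3)
proof (induction k arbitrary: f g)
  case 0
  then show ?case by (auto intro: continuous_on_add)
next
  case (Suc k)
  show ?case
    by (rule Ck_on_SucI[OF assms(1)
          has_derivative_add[OF Ck_on_SucD[OF Suc.prems(1)] Ck_on_SucD[OF Suc.prems(2)]]])
       (use Suc.prems Suc.IH in auto)
qed

text \<open>The product rule writes the derivative as a sum of two products of C^k maps, so the
  induction has to run over all \<open>f\<close> and \<open>g\<close>. Scaling, multiplication and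
  the inner product are instances.\<close>

lemma Ck_on_bilinear:
  assumes "open S" and h: "bounded_bilinear h" and "Ck_on k S f" "Ck_on k S g"
  shows "Ck_on k S (\<lambda>x. h (f x) (g x))"
  using assms(3,4)
proof (induction k arbitrary: f g)
  case 0
  then show ?case using bounded_bilinear.continuous_on[OF h] by simp
next
  case (Suc k)
  show ?case
  proof (rule Ck_on_SucI[OF assms(1) bounded_bilinear.FDERIV[OF h
          Ck_on_SucD[OF Suc.prems(1)] Ck_on_SucD[OF Suc.prems(2)]]])
    fix v
    show "Ck_on k S (\<lambda>x. h (f x) (frechet_derivative g (at x) v)
        + h (frechet_derivative f (at x) v) (g x))"
      by (intro Ck_on_add[OF assms(1)] Suc.IH Ck_on_Suc_imp[OF Suc.prems(1)]
          Ck_on_Suc_imp[OF Suc.prems(2)]) (use Suc.prems in auto)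
  qed
qed

text \<open>The derivative of \<open>1/f\<close> is \<open>- (1/f) f' (1/f)\<close>, again built
  from \<open>1/f\<close>, which is one order less smooth by induction.\<close>

lemma Ck_on_inverse:
  fixes f :: "'a::euclidean_space \<Rightarrow> real"
  assumes "open S" "Ck_on k S f" "\<And>x. x \<in> S \<Longrightarrow> f x \<noteq> 0"
  shows "Ck_on k S (\<lambda>x. inverse (f x))"
  using assms(2)
proof (induction k)
  case 0
  then show ?case using assms(3) by (auto intro: continuous_on_inverse)
next
  case (Suc k)
  note IH = Suc.IH[OF Ck_on_Suc_imp[OF Suc.prems]]
  show ?case
  proof (rule Ck_on_SucI[OF assms(1)
        Deriv.has_derivative_inverse[OF assms(3) Ck_on_SucD[OF Suc.prems]]])
    fix v
    show "Ck_on k S (\<lambda>x. - (inverse (f x) * frechet_derivative f (at x) v * inverse (f x)))"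
      using Ck_on_bilinear[OF assms(1) bounded_bilinear_mult Ck_on_const[of k S "-1::real"]
        Ck_on_bilinear[OF assms(1) bounded_bilinear_mult
          Ck_on_bilinear[OF assms(1) bounded_bilinear_mult IH] IH]] Suc.prems by simp
  qed
qed

section \<open>Smooth maps and smooth families of linear and bilinear maps\<close>

lemma smooth_on_cong:
  "open S \<Longrightarrow> smooth_on S f \<Longrightarrow> (\<And>x. x \<in> S \<Longrightarrow> f x = g x) \<Longrightarrow> smooth_on S g"
  unfolding smooth_on_def using Ck_on_cong by blast

lemma smooth_on_subset: "smooth_on S f \<Longrightarrow> T \<subseteq> S \<Longrightarrow> smooth_on T f"
  unfolding smooth_on_def using Ck_on_subset by blast

lemma smooth_on_local:
  assumes "\<And>x. x \<in> S \<Longrightarrow> \<exists>T. open T \<and> x \<in> T \<and> smooth_on T f"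
  shows "smooth_on S f"
  using assms unfolding smooth_on_def by (meson Ck_on_local)

lemma smooth_on_const: "smooth_on S (\<lambda>x. a)"
  by (simp add: smooth_on_def Ck_on_const)

lemma smooth_on_add:
  "open S \<Longrightarrow> smooth_on S f \<Longrightarrow> smooth_on S g \<Longrightarrow> smooth_on S (\<lambda>x. f x + g x)"
  by (simp add: smooth_on_def Ck_on_add)

lemma smooth_on_bilinear:
  "open S \<Longrightarrow> bounded_bilinear h \<Longrightarrow> smooth_on S f \<Longrightarrow> smooth_on S g
    \<Longrightarrow> smooth_on S (\<lambda>x. h (f x) (g x))"
  by (simp add: smooth_on_def Ck_on_bilinear)

lemmas smooth_on_scaleR = smooth_on_bilinear[OF _ bounded_bilinear_scaleR]
lemmas smooth_on_mult = smooth_on_bilinear[OF _ bounded_bilinear_mult]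
lemmas smooth_on_inner = smooth_on_bilinear[OF _ bounded_bilinear_inner]

lemma smooth_on_divide:
  fixes f g :: "'a::euclidean_space \<Rightarrow> real"
  assumes "open S" "smooth_on S f" "smooth_on S g" "\<And>x. x \<in> S \<Longrightarrow> g x \<noteq> 0"
  shows "smooth_on S (\<lambda>x. f x / g x)"
  using assms unfolding divide_inverse
  by (auto intro!: smooth_on_mult) (auto simp: smooth_on_def intro!: Ck_on_inverse)

lemma smooth_on_diff:
  assumes "open S" "smooth_on S f" "smooth_on S g"
  shows "smooth_on S (\<lambda>x. f x - g x)"
  using smooth_on_add[OF assms(1,2) smooth_on_scaleR[OF assms(1) smooth_on_const[of S "-1"] assms(3)]]
  by simp

lemma smooth_on_sum:
  assumes "open S" "\<And>i. i \<in> I \<Longrightarrow> smooth_on S (f i)"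
  shows "smooth_on S (\<lambda>x. \<Sum>i\<in>I. f i x)"
  using assms(2)
  by (induction I rule: infinite_finite_induct) (auto intro: smooth_on_const smooth_on_add[OF assms(1)])

lemma smooth_on_differentiable: "smooth_on S f \<Longrightarrow> x \<in> S \<Longrightarrow> f differentiable (at x)"
  unfolding smooth_on_def by (metis Ck_on.simps(2))

lemma smooth_on_has_derivative:
  "smooth_on S f \<Longrightarrow> x \<in> S \<Longrightarrow> (f has_derivative frechet_derivative f (at x)) (at x)"
  using smooth_on_differentiable frechet_derivative_works by blast

lemma smooth_on_frechet_derivative:
  "smooth_on S f \<Longrightarrow> smooth_on S (\<lambda>x. frechet_derivative f (at x) v)"
  unfolding smooth_on_def by (metis Ck_on.simps(2))

lemma smooth_on_continuous: "smooth_on S f \<Longrightarrow> continuous_on S f"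
  unfolding smooth_on_def by (metis Ck_on.simps(1))

text \<open>Expanding \<open>X x\<close> in the standard basis leaves a finite sum of smooth
  coefficients times the smooth maps \<open>A x b\<close>.\<close>

lemma smooth_on_linear_family:
  fixes A :: "'a::euclidean_space \<Rightarrow> 'e::euclidean_space \<Rightarrow> 'f::euclidean_space"
  assumes "open S" "\<And>a. smooth_on S (\<lambda>x. A x a)" "\<And>x. x \<in> S \<Longrightarrow> linear (A x)" "smooth_on S X"
  shows "smooth_on S (\<lambda>x. A x (X x))"
proof (rule smooth_on_cong[OF assms(1)])
  show "smooth_on S (\<lambda>x. \<Sum>b\<in>Basis. (X x \<bullet> b) *\<^sub>R A x b)"
    by (intro smooth_on_sum smooth_on_scaleR smooth_on_inner assms smooth_on_const)
next
  fix x assume "x \<in> S"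
  then interpret linear "A x" by (rule assms(3))
  show "(\<Sum>b\<in>Basis. (X x \<bullet> b) *\<^sub>R A x b) = A x (X x)"
    by (simp add: scale[symmetric] sum[symmetric] euclidean_representation)
qed

lemma smooth_on_bilinear_family:
  fixes G :: "'a::euclidean_space \<Rightarrow> 'e::euclidean_space \<Rightarrow> 'e \<Rightarrow> real"
  assumes "open S" "\<And>a b. smooth_on S (\<lambda>x. G x a b)" "\<And>x. x \<in> S \<Longrightarrow> bilinear (G x)"
    and "smooth_on S X" "smooth_on S Y"
  shows "smooth_on S (\<lambda>x. G x (X x) (Y x))"
proof (rule smooth_on_linear_family[where A="\<lambda>x. G x (X x)"])
  fix b
  show "smooth_on S (\<lambda>x. G x (X x) b)"
    by (rule smooth_on_linear_family[where A="\<lambda>x a. G x a b"])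
       (use assms in \<open>auto simp: bilinear_def\<close>)
qed (use assms in \<open>auto simp: bilinear_def\<close>)

section \<open>Symmetry of second derivatives\<close>

lemma mean_value_along:
  fixes f :: "'a::real_normed_vector \<Rightarrow> real"
  assumes "0 < t" "\<And>s. 0 \<le> s \<Longrightarrow> s \<le> t \<Longrightarrow> (f has_derivative f' (x + s *\<^sub>R u)) (at (x + s *\<^sub>R u))"
  obtains s where "0 < s" "s < t" "f (x + t *\<^sub>R u) - f x = t * f' (x + s *\<^sub>R u) u"
proof -
  have "((\<lambda>s. f (x + s *\<^sub>R u)) has_real_derivative f' (x + s *\<^sub>R u) u) (at s)"
    if "0 \<le> s" "s \<le> t" for s
  proof -
    have "((\<lambda>s. f (x + s *\<^sub>R u)) has_derivative (\<lambda>h. f' (x + s *\<^sub>R u) (h *\<^sub>R u))) (at s)"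
      by (rule has_derivative_compose[where f="\<lambda>s. x + s *\<^sub>R u" and g=f])
         (use assms(2)[OF that] in \<open>auto intro!: derivative_eq_intros\<close>)
    then show ?thesis
      using linear_scale[OF has_derivative_linear[OF assms(2)[OF that]]]
      by (simp add: has_field_derivative_def mult_commute_abs)
  qed
  from MVT2[OF assms(1) this] obtain s where "0 < s" "s < t"
      "f (x + t *\<^sub>R u) - f (x + 0 *\<^sub>R u) = (t - 0) * f' (x + s *\<^sub>R u) u"
    by blast
  then show thesis using that by simp
qed

text \<open>The mean value theorem is applied twice: along \<open>u\<close> to the increment of
  \<open>f\<close> in direction \<open>v\<close>, then along \<open>v\<close> to the derivative of
  \<open>f\<close> in direction \<open>u\<close>.\<close>

lemma second_difference:
  fixes f :: "'a::euclidean_space \<Rightarrow> real"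
  assumes "Ck_on 2 (ball x e) f" "0 < t" "t * (norm u + norm v) < e"
  obtains y where "dist x y \<le> t * (norm u + norm v)"
    "f (x + t *\<^sub>R u + t *\<^sub>R v) - f (x + t *\<^sub>R v) - f (x + t *\<^sub>R u) + f x
      = t * t * frechet_derivative (\<lambda>z. frechet_derivative f (at z) u) (at y) v"
proof -
  \<comment> \<open>Both applications take place in the parallelogram spanned by \<open>t u\<close>
    and \<open>t v\<close> at \<open>x\<close>; this bound keeps it inside the ball.\<close>
  have near: "dist x (x + a *\<^sub>R u + b *\<^sub>R v) \<le> t * (norm u + norm v)"
    if "0 \<le> a" "a \<le> t" "0 \<le> b" "b \<le> t" for a b
  proof -
    have "norm (a *\<^sub>R u + b *\<^sub>R v) \<le> a * norm u + b * norm v"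
      using that norm_triangle_ineq[of "a *\<^sub>R u" "b *\<^sub>R v"] by simp
    also have "\<dots> \<le> t * (norm u + norm v)"
      using that by (simp add: distrib_left add_mono mult_right_mono)
    finally show ?thesis 
      by (metis add.assoc add_diff_cancel_left' dist_commute dist_norm)
  qed
  have in_ball: "x + a *\<^sub>R u + b *\<^sub>R v \<in> ball x e"
    if "0 \<le> a" "a \<le> t" "0 \<le> b" "b \<le> t" for a b
    using near[OF that] assms(3) by simp
  have C2: "Ck_on (Suc (Suc 0)) (ball x e) f"
    using assms(1) by (simp add: numeral_2_eq_2)
  have d1: "(f has_derivative frechet_derivative f (at z)) (at z)" if "z \<in> ball x e" for z
    using Ck_on_SucD[OF C2 that] .
  have d2: "((\<lambda>z. frechet_derivative f (at z) u) has_derivative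
      frechet_derivative (\<lambda>z. frechet_derivative f (at z) u) (at z)) (at z)"
    if "z \<in> ball x e" for z
    by (rule Ck_on_SucD[of 0, OF _ that]) (use C2 in simp)
  let ?g = "\<lambda>z. f (z + t *\<^sub>R v) - f z"
  let ?g' = "\<lambda>z w. frechet_derivative f (at (z + t *\<^sub>R v)) w - frechet_derivative f (at z) w"
  obtain a where a: "0 < a" "a < t" "?g (x + t *\<^sub>R u) - ?g x = t * ?g' (x + a *\<^sub>R u) u"
  proof (rule mean_value_along[OF assms(2), of ?g ?g'])
    fix s assume s: "0 \<le> s" "s \<le> t"
    let ?z = "x + s *\<^sub>R u"
    have "((\<lambda>z. f (z + t *\<^sub>R v)) has_derivative frechet_derivative f (at (?z + t *\<^sub>R v))) (at ?z)"
      by (rule has_derivative_compose[where f="\<lambda>z. z + t *\<^sub>R v" and g=f])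
         (use in_ball[of s t] s assms(2) d1 in \<open>auto intro!: derivative_eq_intros\<close>)
    moreover have "(f has_derivative frechet_derivative f (at ?z)) (at ?z)"
      using d1[of ?z] in_ball[of s 0] s assms(2) by simp
    ultimately show "(?g has_derivative ?g' ?z) (at ?z)"
      by (rule has_derivative_diff)
  qed auto
  obtain b where b: "0 < b" "b < t" "?g' (x + a *\<^sub>R u) u
      = t * frechet_derivative (\<lambda>z. frechet_derivative f (at z) u) (at (x + a *\<^sub>R u + b *\<^sub>R v)) v"
    by (rule mean_value_along[OF assms(2),
          of "\<lambda>z. frechet_derivative f (at z) u" 
             "\<lambda>z. frechet_derivative (\<lambda>z. frechet_derivative f (at z) u) (at z)"
             "x + a *\<^sub>R u" v])
       (use d2 in_ball[of a] a in auto)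
  show thesis
  proof (rule that[OF near[of a b]])
    show "f (x + t *\<^sub>R u + t *\<^sub>R v) - f (x + t *\<^sub>R v) - f (x + t *\<^sub>R u) + f x = t * t *
       frechet_derivative (\<lambda>z. frechet_derivative f (at z) u) (at (x + a *\<^sub>R u + b *\<^sub>R v)) v"
      using a(3) unfolding b(3) by (simp add: algebra_simps)
  qed (use a b in auto)
qed

text \<open>The second difference does not change when \<open>u\<close> and \<open>v\<close> are
  exchanged. Hence the two mixed derivatives take equal values at points that tend to
  \<open>x\<close> with the step size, and continuity gives equality at \<open>x\<close>.\<close>

lemma symmetric_second_derivative_real:
  fixes f :: "'a::euclidean_space \<Rightarrow> real"
  assumes "open S" "x \<in> S" "smooth_on S f"
  shows "frechet_derivative (\<lambda>z. frechet_derivative f (at z) u) (at x) v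
       = frechet_derivative (\<lambda>z. frechet_derivative f (at z) v) (at x) u"
proof -
  let ?H = "\<lambda>u v y. frechet_derivative (\<lambda>z. frechet_derivative f (at z) u) (at y) v"
  obtain e where e: "e > 0" "ball x e \<subseteq> S"
    using assms open_contains_ball by blast
  define N where "N = norm u + norm v"
  have C2: "Ck_on 2 (ball x e) f"
    using assms(3) e Ck_on_subset unfolding smooth_on_def by blast
  have "isCont (?H u v) x" for u v
    using smooth_on_continuous[OF smooth_on_frechet_derivative[OF smooth_on_frechet_derivative[OF assms(3)]]]
      assms(1,2) continuous_on_eq_continuous_at by blast
  then have "(\<lambda>n. ?H u v (y n)) \<longlonglongrightarrow> ?H u v x" if "y \<longlonglongrightarrow> x" for u v y
    using that isCont_tendsto_compose by blast
  note lim = this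
  \<comment> \<open>Step sizes that tend to 0 and satisfy \<open>t n * N < e\<close> from
    \<open>n = 0\<close> on; the added 1 keeps the denominator positive when \<open>u\<close> and
    \<open>v\<close> both vanish.\<close>
  define t where "t n = e / ((real n + 1) * (N + 1))" for n
  have N: "N \<ge> 0" by (simp add: N_def)
  have t: "t n > 0" "t n * N < e" for n
  proof -
    show "t n > 0" using e N by (simp add: t_def)
    have "N < 1 * (N + 1)" by simp
    also have "\<dots> \<le> (real n + 1) * (N + 1)" using N by (intro mult_right_mono) auto
    finally have "e * N < e * ((real n + 1) * (N + 1))" using e by simp
    then show "t n * N < e" using N by (simp add: t_def pos_divide_less_eq)
  qed
  have "\<exists>y z. dist x y \<le> t n * N \<and> dist x z \<le> t n * N \<and> ?H u v y = ?H v u z" for n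
  proof -
    obtain y where y: "dist x y \<le> t n * N"
      "f (x + t n *\<^sub>R u + t n *\<^sub>R v) - f (x + t n *\<^sub>R v) - f (x + t n *\<^sub>R u) + f x
        = t n * t n * ?H u v y"
      using second_difference[OF C2 t(1)[of n], of u v] t(2)[of n] unfolding N_def by metis
    obtain z where z: "dist x z \<le> t n * N"
      "f (x + t n *\<^sub>R v + t n *\<^sub>R u) - f (x + t n *\<^sub>R u) - f (x + t n *\<^sub>R v) + f x
        = t n * t n * ?H v u z"
      using second_difference[OF C2 t(1)[of n], of v u] t(2)[of n] unfolding N_def
      by (metis add.commute)
    have "t n * t n * ?H u v y = t n * t n * ?H v u z"
      using y(2) z(2) by (simp add: algebra_simps)
    then show ?thesis using y(1) z(1) t(1)[of n] by auto
  qed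
  then obtain y z where yz: "\<And>n. dist x (y n) \<le> t n * N" "\<And>n. dist x (z n) \<le> t n * N"
      "\<And>n. ?H u v (y n) = ?H v u (z n)"
    by metis
  have "(\<lambda>n. 1 / real (Suc n) * (e * N / (N + 1))) \<longlonglongrightarrow> 0 * (e * N / (N + 1))"
    by (intro tendsto_intros LIMSEQ_Suc lim_1_over_n)
  then have tN: "(\<lambda>n. t n * N) \<longlonglongrightarrow> 0"
    by (simp add: t_def field_simps)
  have "w \<longlonglongrightarrow> x" if "\<And>n. dist x (w n) \<le> t n * N" for w :: "nat \<Rightarrow> 'a"
    by (rule tendsto_dist_iff[THEN iffD2])
       (rule tendsto_sandwich[OF _ _ tendsto_const tN], use that in \<open>auto simp: dist_commute\<close>)
  with yz have "y \<longlonglongrightarrow> x" "z \<longlonglongrightarrow> x" by auto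
  from lim[OF this(1), of u v] lim[OF this(2), of v u] show ?thesis
    unfolding yz(3) by (rule LIMSEQ_unique)
qed

lemma symmetric_second_derivative:
  fixes f :: "'a::euclidean_space \<Rightarrow> 'b::euclidean_space"
  assumes "open S" "x \<in> S" "smooth_on S f"
  shows "frechet_derivative (\<lambda>z. frechet_derivative f (at z) u) (at x) v
       = frechet_derivative (\<lambda>z. frechet_derivative f (at z) v) (at x) u"
proof (rule euclidean_eqI)
  fix b :: 'b assume "b \<in> Basis"
  \<comment> \<open>Taking a component commutes with differentiation, which reduces the claim to
    real-valued functions.\<close>
  have fd: "frechet_derivative (\<lambda>z. g z \<bullet> b) (at z) w = frechet_derivative g (at z) w \<bullet> b"
    if "smooth_on S g" "z \<in> S" for g :: "'a \<Rightarrow> 'b" and z w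
    using frechet_derivative_at[OF has_derivative_inner_left[OF smooth_on_has_derivative[OF that]]]
    by metis
  have "frechet_derivative (\<lambda>z. frechet_derivative f (at z) u) (at x) v \<bullet> b
      = frechet_derivative (\<lambda>z. frechet_derivative (\<lambda>z. f z \<bullet> b) (at z) u) (at x) v" for u v
  proof -
    have "frechet_derivative (\<lambda>z. frechet_derivative f (at z) u) (at x) v \<bullet> b
      = frechet_derivative (\<lambda>z. frechet_derivative f (at z) u \<bullet> b) (at x) v"
      using fd[OF smooth_on_frechet_derivative[OF assms(3)] assms(2)] by simp
    also have "\<dots> = frechet_derivative (\<lambda>z. frechet_derivative (\<lambda>z. f z \<bullet> b) (at z) u) (at x) v"
      by (rule fun_cong[OF frechet_derivative_transform_within_open[OF _ assms(1,2)]])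
         (use fd[OF assms(3)] assms in \<open>auto intro!: smooth_on_differentiable smooth_on_inner
            smooth_on_frechet_derivative smooth_on_const\<close>)
    finally show ?thesis .
  qed
  then show "frechet_derivative (\<lambda>z. frechet_derivative f (at z) u) (at x) v \<bullet> b
      = frechet_derivative (\<lambda>z. frechet_derivative f (at z) v) (at x) u \<bullet> b"
    using symmetric_second_derivative_real[OF assms(1,2) smooth_on_inner[OF assms(1,3) smooth_on_const]]
    by metis
qed

section \<open>Orthogonal projections depending smoothly on a parameter\<close>

locale scalar_product =
  fixes G :: "'e::euclidean_space \<Rightarrow> 'e \<Rightarrow> real"
  assumes bilinear: "bilinear G"
    and sym: "G v w = G w v"
    and pos: "v \<noteq> 0 \<Longrightarrow> G v v > 0"
begin

lemma linear_left: "linear (\<lambda>v. G v w)" and linear_right: "linear (G v)"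
  using bilinear by (auto simp: bilinear_def)

lemma eq_0_iff: "G v v = 0 \<longleftrightarrow> v = 0"
  using pos[of v] bilinear_lzero[OF bilinear] by force

lemma orth_span: "(\<And>u. u \<in> S \<Longrightarrow> G u v = 0) \<Longrightarrow> w \<in> span S \<Longrightarrow> G w v = 0"
  using linear_eq_0_on_span[OF linear_left[of v]] by blast

text \<open>Two candidates differ by a vector of \<open>S\<close> that is orthogonal to itself, so
  the definite description is determined.\<close>

lemma orth_proj_eqI:
  assumes "subspace S" "w \<in> S" "\<And>u. u \<in> S \<Longrightarrow> G (v - w) u = 0"
  shows "orth_proj G S v = w"
  unfolding orth_proj_def
proof (rule the_equality)
  fix z assume z: "z \<in> S \<and> (\<forall>u\<in>S. G (v - z) u = 0)"
  have "z - w \<in> S" using assms z by (simp add: subspace_diff)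
  with assms(3) z have "G (v - w) (z - w) - G (v - z) (z - w) = 0" by simp
  then have "G (z - w) (z - w) = 0"
    by (simp flip: bilinear_lsub[OF bilinear])
  then show "z = w" by (simp add: eq_0_iff)
qed (use assms in auto)

end

section \<open>Gram-Schmidt orthogonalisation\<close>

text \<open>This is the orthogonal projection onto the span of the first \<open>n\<close> vectors
  once these are mutually orthogonal. Dividing by \<open>G (k i) (k i)\<close> replaces
  normalisation, so no square roots have to be differentiated.\<close>

definition frame_proj ::
    "('e \<Rightarrow> 'e \<Rightarrow> real) \<Rightarrow> (nat \<Rightarrow> 'e::euclidean_space) \<Rightarrow> nat \<Rightarrow> 'e \<Rightarrow> 'e" where
  "frame_proj G k n v = (\<Sum>i<n. (G v (k i) / G (k i) (k i)) *\<^sub>R k i)"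

function gram_schmidt ::
    "('e \<Rightarrow> 'e \<Rightarrow> real) \<Rightarrow> (nat \<Rightarrow> 'e::euclidean_space) \<Rightarrow> nat \<Rightarrow> 'e" where
  "gram_schmidt G h n = h n - (\<Sum>i\<in>{..<n}.
     (G (h n) (gram_schmidt G h i) / G (gram_schmidt G h i) (gram_schmidt G h i))
       *\<^sub>R gram_schmidt G h i)"
  by auto
termination by (relation "Wellfounded.measure (\<lambda>(G, h, n). n)") auto

declare gram_schmidt.simps [simp del]

lemma gram_schmidt_eq: "gram_schmidt G h n = h n - frame_proj G (gram_schmidt G h) n (h n)"
  by (subst gram_schmidt.simps) (simp add: frame_proj_def)

lemma frame_proj_in_span: "frame_proj G k n v \<in> span (k ` {..<n})"
  unfolding frame_proj_def by (intro span_sum span_scale) (auto intro: span_base)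

lemma (in scalar_product) frame_proj_orth:
  assumes "\<And>i j. i < n \<Longrightarrow> j < n \<Longrightarrow> i \<noteq> j \<Longrightarrow> G (k i) (k j) = 0" "i < n"
  shows "G (v - frame_proj G k n v) (k i) = 0"
proof -
  have "G (frame_proj G k n v) (k i) = (\<Sum>j<n. G v (k j) / G (k j) (k j) * G (k j) (k i))"
    by (simp add: frame_proj_def linear_sum[OF linear_left] linear_scale[OF linear_left])
  also have "\<dots> = (\<Sum>j<n. if j = i then G v (k i) / G (k i) (k i) * G (k i) (k i) else 0)"
    using assms by (intro sum.cong) auto
  \<comment> \<open>A zero vector \<open>k i\<close> does no harm: division by zero yields 0, and
    \<open>G v (k i)\<close> is 0 too.\<close>
  also have "\<dots> = G v (k i)"
    using assms(2) eq_0_iff[of "k i"] bilinear_rzero[OF bilinear] by auto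
  finally show ?thesis by (simp add: bilinear_lsub[OF bilinear])
qed

text \<open>Of two vectors the later one is a residual of the projection onto its predecessors.
  These are mutually orthogonal by induction on the larger index, so the residual is orthogonal to
  each of them.\<close>

lemma (in scalar_product) gram_schmidt_orth:
  "i \<noteq> j \<Longrightarrow> G (gram_schmidt G h i) (gram_schmidt G h j) = 0"
proof (induction "max i j" arbitrary: i j rule: less_induct)
  case less
  have *: "G (gram_schmidt G h m) (gram_schmidt G h l) = 0" if "l < m" "m = max i j" for l m
    unfolding gram_schmidt_eq[of G h m]
    by (rule frame_proj_orth) (use less.hyps that in auto)
  show ?case
    using *[of i j] *[of j i] sym less.prems by (cases "i < j") (auto simp: max_def)
qed

lemma span_gram_schmidt: "span (gram_schmidt G h ` {..<n}) = span (h ` {..<n})"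
proof (induction n)
  case (Suc n)
  let ?k = "gram_schmidt G h"
  have "span (?k ` {..<Suc n}) = span (insert (?k n) (span (?k ` {..<n})))"
    by (simp add: lessThan_Suc span_insert span_span)
  \<comment> \<open>The old and the new vector differ by an element of the span of the earlier ones,
    so adjoining either gives the same space.\<close>
  also have "\<dots> = span (insert (h n) (span (?k ` {..<n})))"
  proof -
    let ?S = "span (?k ` {..<n})"
    let ?p = "frame_proj G ?k n (h n)"
    have p: "?p \<in> ?S" by (rule frame_proj_in_span)
    have "h n - ?p \<in> span (insert (h n) ?S)" "?k n + ?p \<in> span (insert (?k n) ?S)"
      using p by (auto intro: span_diff span_add span_base)
    then have "?k n \<in> span (insert (h n) ?S)" "h n \<in> span (insert (?k n) ?S)"
      by (simp_all add: gram_schmidt_eq[of G h n])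
    then show ?thesis
      unfolding span_eq by (auto intro: span_base)
  qed
  also have "\<dots> = span (h ` {..<Suc n})"
    using Suc by (simp add: lessThan_Suc span_insert span_span)
  finally show ?case .
qed simp

lemma gram_schmidt_nonzero:
  assumes "h n \<notin> span (h ` {..<n})"
  shows "gram_schmidt G h n \<noteq> 0"
  using assms frame_proj_in_span[of G "gram_schmidt G h" n "h n"]
  by (auto simp: gram_schmidt_eq[of G h n] span_gram_schmidt)

lemma smooth_on_frame_proj:
  assumes "open S" "\<And>a b. smooth_on S (\<lambda>x. G x a b)" "\<And>x. x \<in> S \<Longrightarrow> scalar_product (G x)"
    and "\<And>i. i < n \<Longrightarrow> smooth_on S (\<lambda>x. k x i)" "\<And>i x. i < n \<Longrightarrow> x \<in> S \<Longrightarrow> k x i \<noteq> 0"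
    and "smooth_on S X"
  shows "smooth_on S (\<lambda>x. frame_proj (G x) (k x) n (X x))"
proof -
  note sp = scalar_product.eq_0_iff[OF assms(3)] scalar_product.bilinear[OF assms(3)]
  have "smooth_on S (\<lambda>x. G x (Y x) (Z x))" if "smooth_on S Y" "smooth_on S Z" for Y Z
    using smooth_on_bilinear_family[OF assms(1,2) sp(2) that] .
  then show ?thesis
    unfolding frame_proj_def
    by (intro smooth_on_sum smooth_on_scaleR smooth_on_divide) (use assms sp(1) in auto)
qed

lemma smooth_on_gram_schmidt:
  assumes "open S" "\<And>a b. smooth_on S (\<lambda>x. G x a b)" "\<And>x. x \<in> S \<Longrightarrow> scalar_product (G x)"
    and "\<And>i. i < N \<Longrightarrow> smooth_on S (\<lambda>x. h x i)"
    and "\<And>i x. i < N \<Longrightarrow> x \<in> S \<Longrightarrow> h x i \<notin> span (h x ` {..<i})" "n < N"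
  shows "smooth_on S (\<lambda>x. gram_schmidt (G x) (h x) n)"
  using assms(6)
proof (induction n rule: less_induct)
  case (less n)
  then show ?case
    unfolding gram_schmidt_eq[of _ _ n]
    by (intro smooth_on_diff smooth_on_frame_proj assms gram_schmidt_nonzero) auto
qed

section \<open>Projection onto the kernel of a smooth family of surjections\<close>

text \<open>No smooth frame of the kernels is given, but their orthogonal complements have an
  explicit one. The kernel part of \<open>X\<close> is therefore obtained by subtracting its
  projection onto the complement.\<close>

lemma smooth_kernel_projection:
  fixes A :: "'a::euclidean_space \<Rightarrow> 'e::euclidean_space \<Rightarrow> 'f::euclidean_space"
  assumes S: "open S" and G: "\<And>a b. smooth_on S (\<lambda>x. G x a b)"
    and sp: "\<And>x. x \<in> S \<Longrightarrow> scalar_product (G x)"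
    and A: "\<And>a. smooth_on S (\<lambda>x. A x a)" and lin: "\<And>x. x \<in> S \<Longrightarrow> linear (A x)"
    and surj: "\<And>x. x \<in> S \<Longrightarrow> surj (A x)" and X: "smooth_on S X"
  obtains Y where "smooth_on S Y" "\<And>x. x \<in> S \<Longrightarrow> A x (Y x) = 0"
    "\<And>x u. x \<in> S \<Longrightarrow> A x u = 0 \<Longrightarrow> G x (X x - Y x) u = 0"
proof -
  obtain e :: "nat \<Rightarrow> 'e" where e: "bij_betw e {..<DIM('e)} Basis"
    using ex_bij_betw_nat_finite[OF finite_Basis] by (auto simp: atLeast0LessThan)
  obtain f :: "nat \<Rightarrow> 'f" where f: "bij_betw f {..<DIM('f)} Basis"
    using ex_bij_betw_nat_finite[OF finite_Basis] by (auto simp: atLeast0LessThan)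
  have f_inner: "f i \<bullet> f j = (if i = j then 1 else 0)" if "i < DIM('f)" "j < DIM('f)" for i j
    using that f bij_betwE[OF f] by (auto simp: inner_Basis bij_betw_def inj_on_eq_iff)
  have e_indep: "e i \<notin> span (e ` {..<i})" if "i < DIM('e)" for i
  proof -
    have "e ` {..<i} \<subseteq> Basis - {e i}" "e i \<in> Basis"
      using that e by (auto simp: bij_betw_def inj_on_eq_iff)
    then show ?thesis
      using independent_Basis unfolding dependent_def by (meson span_mono subsetD)
  qed
  \<comment> \<open>An orthogonal frame of the whole space, in which gradients can be written down
    without inverting the Gram matrix of \<open>G x\<close>.\<close>
  define k where "k x = gram_schmidt (G x) e" for x
  define h where
    "h x j = (\<Sum>i<DIM('e). ((A x (k x i) \<bullet> f j) / G x (k x i) (k x i)) *\<^sub>R k x i)" for x j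
  define l where "l x = gram_schmidt (G x) (h x)" for x
  define Y where "Y x = X x - frame_proj (G x) (l x) DIM('f) (X x)" for x
  \<comment> \<open>\<open>h x j\<close> is the \<open>G x\<close>-gradient of the \<open>j\<close>-th component of \<open>A x\<close>, so the \<open>h x j\<close> span the
    orthogonal complement of the kernel of \<open>A x\<close>.\<close>
  have k_smooth: "smooth_on S (\<lambda>x. k x i)" if "i < DIM('e)" for i
    unfolding k_def
    by (rule smooth_on_gram_schmidt[where N="DIM('e)" and h="\<lambda>x. e"])
       (use S G sp e_indep that in \<open>auto intro: smooth_on_const\<close>)
  have k0: "k x i \<noteq> 0" if "i < DIM('e)" for x i
    unfolding k_def using gram_schmidt_nonzero e_indep that by blast
  have h_smooth: "smooth_on S (\<lambda>x. h x j)" for j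
  proof -
    have "smooth_on S (\<lambda>x. A x (k x i))" if "i < DIM('e)" for i
      using smooth_on_linear_family[OF S A lin k_smooth[OF that]] .
    moreover have "smooth_on S (\<lambda>x. G x (k x i) (k x i))" if "i < DIM('e)" for i
      using smooth_on_bilinear_family[OF S G scalar_product.bilinear[OF sp] k_smooth k_smooth]
        that by blast
    ultimately show ?thesis
      unfolding h_def
      by (intro smooth_on_sum smooth_on_scaleR smooth_on_divide smooth_on_inner smooth_on_const S)
         (use k_smooth k0 scalar_product.eq_0_iff[OF sp] in auto)
  qed
  have h_grad: "G x (h x j) v = A x v \<bullet> f j" if x: "x \<in> S" for x j v
  proof -
    interpret scalar_product "G x" by (rule sp[OF x])
    have "linear (\<lambda>v. A x v \<bullet> f j)"
      using lin[OF x] by (simp add: linear_iff inner_left_distrib)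
    moreover have "v \<in> span (k x ` {..<DIM('e)})"
      using e by (simp add: k_def span_gram_schmidt bij_betw_def)
    moreover have "G x (h x j) u = A x u \<bullet> f j" if "u \<in> k x ` {..<DIM('e)}" for u
    proof -
      from that obtain m where m: "m < DIM('e)" "u = k x m" by auto
      have "G x (h x j) (k x m)
          = (\<Sum>i<DIM('e). A x (k x i) \<bullet> f j / G x (k x i) (k x i) * G x (k x i) (k x m))"
        by (simp add: h_def linear_sum[OF linear_left] linear_scale[OF linear_left])
      also have "\<dots> = (\<Sum>i<DIM('e). if i = m then A x (k x m) \<bullet> f j else 0)"
        using gram_schmidt_orth[of _ m e] k0[of m x] eq_0_iff[of "k x m"] m(1)
        by (intro sum.cong) (auto simp: k_def)
      finally have "G x (h x j) (k x m) = (\<Sum>i<DIM('e). if i = m then A x (k x m) \<bullet> f j else 0)" .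
      then show ?thesis using m by simp
    qed
    ultimately show ?thesis
      using linear_eq_on_span[OF linear_right] by blast
  qed
  have h_indep: "h x j \<notin> span (h x ` {..<j})" if x: "x \<in> S" and j: "j < DIM('f)" for x j
  proof
    interpret scalar_product "G x" by (rule sp[OF x])
    assume *: "h x j \<in> span (h x ` {..<j})"
    \<comment> \<open>A preimage of \<open>f j\<close> is orthogonal to the earlier gradients but
      has product 1 with \<open>h x j\<close>; this is where surjectivity gives
      independence.\<close>
    obtain w where w: "A x w = f j" using surj[OF x] by (metis surjD)
    have "G x (h x j) w = 0"
      by (rule orth_span[OF _ *]) (use h_grad[OF x] w f_inner j in auto)
    then show False using h_grad[OF x] w f_inner j by simp
  qed
  have l_smooth: "smooth_on S (\<lambda>x. l x j)" if "j < DIM('f)" for j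
    unfolding l_def
    by (rule smooth_on_gram_schmidt[where N="DIM('f)"])
       (use S G sp h_smooth h_indep that in auto)
  have l0: "l x j \<noteq> 0" if "x \<in> S" "j < DIM('f)" for x j
    unfolding l_def using gram_schmidt_nonzero h_indep that by blast
  show thesis
  proof (rule that)
    show "smooth_on S Y"
      unfolding Y_def using l_smooth l0 S G sp X by (intro smooth_on_diff smooth_on_frame_proj) auto
  next
    fix x assume x: "x \<in> S"
    interpret scalar_product "G x" by (rule sp[OF x])
    show "A x (Y x) = 0"
    proof (rule euclidean_eqI)
      fix b :: 'f assume "b \<in> Basis"
      then obtain j where j: "j < DIM('f)" "b = f j" using f by (auto simp: bij_betw_def)
      \<comment> \<open>The \<open>j\<close>-th component of \<open>A x (Y x)\<close> is the product
        of \<open>h x j\<close> with \<open>Y x\<close>, and \<open>Y x\<close> is orthogonal to the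
        span of all gradients.\<close>
      have "h x j \<in> span (l x ` {..<DIM('f)})"
        unfolding l_def span_gram_schmidt using j by (auto intro: span_base)
      moreover have "G x u (Y x) = 0" if "u \<in> l x ` {..<DIM('f)}" for u
        using that gram_schmidt_orth frame_proj_orth[of "DIM('f)" "l x" _ "X x"] sym[of u "Y x"]
        by (auto simp: l_def Y_def)
      ultimately show "A x (Y x) \<bullet> b = 0 \<bullet> b"
        using orth_span[of "l x ` {..<DIM('f)}" "Y x" "h x j"] h_grad[OF x] j by simp
    qed
    fix u assume u: "A x u = 0"
    have "X x - Y x \<in> span (h x ` {..<DIM('f)})"
      using frame_proj_in_span[of "G x" "l x"] by (simp add: Y_def l_def span_gram_schmidt)
    then show "G x (X x - Y x) u = 0"
      by (rule orth_span[rotated]) (use h_grad[OF x] u in auto)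
  qed
qed

text \<open>The pointwise statement is the smooth one for constant families, with the real line as a
  dummy parameter space.\<close>

lemma kernel_projection_exists:
  fixes A :: "'e::euclidean_space \<Rightarrow> 'f::euclidean_space"
  assumes "scalar_product G" "linear A" "surj A"
  obtains w where "A w = 0" "\<And>u. A u = 0 \<Longrightarrow> G (v - w) u = 0"
proof -
  obtain Y where "\<And>x::real. A (Y x) = 0" "\<And>(x::real) u. A u = 0 \<Longrightarrow> G (v - Y x) u = 0"
    by (rule smooth_kernel_projection[of UNIV "\<lambda>_. G" "\<lambda>_. A" "\<lambda>_. v"])
       (use assms in \<open>auto intro: smooth_on_const\<close>)
  then show thesis using that by blast
qed

section \<open>Changes of charts\<close>

text \<open>A common form of \<open>to_coords\<close> and \<open>from_coords\<close>, which have the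
  selected chart at one end; linearity and invertibility are thus proved once for all transition
  maps.\<close>

definition chart_deriv ::
    "('m, 'e::euclidean_space) chart \<Rightarrow> ('m, 'e) chart \<Rightarrow> 'm \<Rightarrow> 'e \<Rightarrow> 'e" where
  "chart_deriv c d p = frechet_derivative (chart_map d \<circ> chart_inv c) (at (chart_map c p))"

lemma to_coords_eq: "to_coords M c p = chart_deriv (chart_at M p) c p"
  and from_coords_eq: "from_coords M c p = chart_deriv c (chart_at M p) p"
  by (auto simp: to_coords_def from_coords_def chart_deriv_def)

locale manifold =
  fixes M :: "('m::{t2_space,second_countable_topology}, 'e::euclidean_space) chart set"
  assumes smooth_manifold: "smooth_manifold M"
begin

lemma chart_at: "chart_at M p \<in> M" "p \<in> chart_dom (chart_at M p)"
proof -
  have "\<exists>c. c \<in> M \<and> p \<in> chart_dom c"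
    using smooth_manifold unfolding smooth_manifold_def by blast
  from someI_ex[OF this] show "chart_at M p \<in> M" "p \<in> chart_dom (chart_at M p)"
    by (auto simp: chart_at_def)
qed

lemma chart_homeomorphism:
  assumes "c \<in> M"
  shows "open (chart_dom c)" "open (chart_map c ` chart_dom c)"
    "homeomorphism (chart_dom c) (chart_map c ` chart_dom c) (chart_map c) (chart_inv c)"
  using assms smooth_manifold unfolding smooth_manifold_def by blast+

lemma chart_inv_map: "c \<in> M \<Longrightarrow> p \<in> chart_dom c \<Longrightarrow> chart_inv c (chart_map c p) = p"
  using chart_homeomorphism(3) by (simp add: homeomorphism_def)

lemma open_chart_image:
  assumes "c \<in> M" "open W"
  shows "open (chart_map c ` (chart_dom c \<inter> W))"
proof -
  have "chart_map c ` (chart_dom c \<inter> W) = chart_map c ` chart_dom c \<inter> chart_inv c -` W"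
    using chart_inv_map[OF assms(1)] by auto
  moreover have "open \<dots>"
    using chart_homeomorphism[OF assms(1)] assms(2)
    by (intro continuous_open_preimage) (auto simp: homeomorphism_def)
  ultimately show ?thesis by simp
qed

lemma chart_change_has_derivative:
  assumes "c \<in> M" "d \<in> M" "p \<in> chart_dom c" "p \<in> chart_dom d"
  shows "(chart_map d \<circ> chart_inv c has_derivative chart_deriv c d p) (at (chart_map c p))"
  unfolding chart_deriv_def
  by (rule smooth_on_has_derivative[of "chart_map c ` (chart_dom c \<inter> chart_dom d)"])
     (use smooth_manifold assms in \<open>auto simp: smooth_manifold_def\<close>)

lemma linear_chart_deriv:
  assumes "c \<in> M" "d \<in> M" "p \<in> chart_dom c" "p \<in> chart_dom d"
  shows "linear (chart_deriv c d p)"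
  using has_derivative_linear chart_change_has_derivative[OF assms] by blast

text \<open>The chain rule for a change of chart. The factorisation through \<open>d\<close> holds
  only over the overlap of the two domains, whose image is open, and that suffices for a
  derivative.\<close>

lemma has_derivative_chart_change:
  assumes "c \<in> M" "d \<in> M" "p \<in> chart_dom c" "p \<in> chart_dom d"
    and "(f \<circ> chart_inv d has_derivative f') (at (chart_map d p))"
  shows "(f \<circ> chart_inv c has_derivative f' \<circ> chart_deriv c d p) (at (chart_map c p))"
proof (rule has_derivative_transform_within_open)
  show "((f \<circ> chart_inv d) \<circ> (chart_map d \<circ> chart_inv c) has_derivative f' \<circ> chart_deriv c d p)
      (at (chart_map c p))"
    using chart_change_has_derivative[OF assms(1-4)] assms(5)
    by (intro diff_chain_at) (use assms in \<open>auto simp: chart_inv_map[OF assms(1)]\<close>)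
  show "open (chart_map c ` (chart_dom c \<inter> chart_dom d))"
    using open_chart_image chart_homeomorphism assms by blast
qed (use assms in \<open>auto simp: chart_inv_map[OF assms(1)] chart_inv_map[OF assms(2)]\<close>)

lemma chart_deriv_self:
  assumes "c \<in> M" "p \<in> chart_dom c"
  shows "chart_deriv c c p = id"
proof -
  have "(chart_map c \<circ> chart_inv c has_derivative id) (at (chart_map c p))"
    by (rule has_derivative_transform_within_open[OF has_derivative_id, of "chart_map c ` chart_dom c"])
       (use chart_homeomorphism(2)[OF assms(1)] assms(2) in \<open>auto simp: chart_inv_map[OF assms(1)]\<close>)
  then show ?thesis
    unfolding chart_deriv_def by (rule frechet_derivative_at[symmetric])
qed

text \<open>Differentiates the identity in the chart \<open>c\<close> in two ways, directly and by
  passing through \<open>d\<close>.\<close>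

lemma chart_deriv_inverse:
  assumes "c \<in> M" "d \<in> M" "p \<in> chart_dom c" "p \<in> chart_dom d"
  shows "chart_deriv d c p (chart_deriv c d p v) = v"
proof -
  have "(chart_map c \<circ> chart_inv c has_derivative chart_deriv d c p \<circ> chart_deriv c d p)
      (at (chart_map c p))"
    by (intro has_derivative_chart_change chart_change_has_derivative assms)
  then have "chart_deriv d c p \<circ> chart_deriv c d p = chart_deriv c c p"
    unfolding chart_deriv_def[of c c] by (rule frechet_derivative_at)
  then show ?thesis
    using chart_deriv_self assms by (metis comp_apply id_apply)
qed

lemma
  assumes "c \<in> M" "p \<in> chart_dom c"
  shows linear_to_coords: "linear (to_coords M c p)"
    and linear_from_coords: "linear (from_coords M c p)"
    and to_from_coords: "to_coords M c p (from_coords M c p v) = v"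
    and from_to_coords: "from_coords M c p (to_coords M c p v) = v"
  using assms chart_at
  by (simp_all add: to_coords_eq from_coords_eq linear_chart_deriv chart_deriv_inverse)

lemma to_coords_chart_at: "to_coords M (chart_at M p) p v = v"
  by (simp add: to_coords_eq chart_deriv_self chart_at)

section \<open>Operations on smooth vector fields\<close>

lemma vector_fields_iff:
  "X \<in> vector_fields M \<longleftrightarrow> (\<forall>c\<in>M. smooth_on (chart_map c ` chart_dom c) (field_in_chart M c X))"
  by (simp add: vector_fields_def smooth_field_on_def)

lemma field_in_chart_map:
  "c \<in> M \<Longrightarrow> p \<in> chart_dom c \<Longrightarrow> field_in_chart M c X (chart_map c p) = to_coords M c p (X p)"
  by (simp add: field_in_chart_def chart_inv_map)

lemma vector_fields_add:
  assumes "X \<in> vector_fields M" "Y \<in> vector_fields M"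
  shows "(\<lambda>p. X p + Y p) \<in> vector_fields M"
  unfolding vector_fields_iff
proof
  fix c assume c: "c \<in> M"
  show "smooth_on (chart_map c ` chart_dom c) (field_in_chart M c (\<lambda>p. X p + Y p))"
    by (rule smooth_on_cong[OF _ smooth_on_add[of _ "field_in_chart M c X" "field_in_chart M c Y"]])
       (use c assms chart_homeomorphism(2) in
         \<open>auto simp: vector_fields_iff field_in_chart_map linear_add[OF linear_to_coords]\<close>)
qed

lemma vector_fields_scale:
  assumes "X \<in> vector_fields M"
  shows "(\<lambda>p. a *\<^sub>R X p) \<in> vector_fields M"
  unfolding vector_fields_iff
proof
  fix c assume c: "c \<in> M"
  show "smooth_on (chart_map c ` chart_dom c) (field_in_chart M c (\<lambda>p. a *\<^sub>R X p))"
    by (rule smooth_on_cong[OF _ smooth_on_scaleR[OF _ smooth_on_const, of _ "field_in_chart M c X" a]])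
       (use c assms chart_homeomorphism(2) in
         \<open>auto simp: vector_fields_iff field_in_chart_map linear_scale[OF linear_to_coords]\<close>)
qed

lemma vector_fields_diff:
  assumes "X \<in> vector_fields M" "Y \<in> vector_fields M"
  shows "(\<lambda>p. X p - Y p) \<in> vector_fields M"
  using vector_fields_add[OF assms(1) vector_fields_scale[OF assms(2), of "-1"]] by simp

lemma vector_fields_zero: "(\<lambda>p. 0) \<in> vector_fields M"
  unfolding vector_fields_iff
proof
  fix c assume c: "c \<in> M"
  show "smooth_on (chart_map c ` chart_dom c) (field_in_chart M c (\<lambda>p. 0))"
    by (rule smooth_on_cong[OF _ smooth_on_const[of _ 0]])
       (use c chart_homeomorphism(2) in
         \<open>auto simp: field_in_chart_map linear_0[OF linear_to_coords]\<close>)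
qed

lemma vector_fields_complex_structure:
  assumes "almost_complex_structure M J" "X \<in> vector_fields M"
  shows "(\<lambda>p. J p (X p)) \<in> vector_fields M"
  unfolding vector_fields_iff
proof
  fix c assume c: "c \<in> M"
  \<comment> \<open>\<open>J\<close> in the chart \<open>c\<close>, a smooth family of matrices, to
    be applied to the components of \<open>X\<close>.\<close>
  let ?A = "\<lambda>x a. let p = chart_inv c x in to_coords M c p (J p (from_coords M c p a))"
  have "smooth_on (chart_map c ` chart_dom c) (\<lambda>x. ?A x (field_in_chart M c X x))"
  proof (rule smooth_on_linear_family[where A="?A"])
    fix x assume "x \<in> chart_map c ` chart_dom c"
    then obtain p where p: "p \<in> chart_dom c" "x = chart_map c p" by auto
    have "linear (to_coords M c p \<circ> (J p \<circ> from_coords M c p))"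
      using linear_to_coords[OF c p(1)] linear_from_coords[OF c p(1)] assms(1)
      by (intro linear_compose) (auto simp: almost_complex_structure_def)
    then show "linear (?A x)"
      using p c by (simp add: chart_inv_map o_def Let_def)
  qed (use c assms chart_homeomorphism(2) in \<open>auto simp: vector_fields_iff almost_complex_structure_def\<close>)
  then show "smooth_on (chart_map c ` chart_dom c) (field_in_chart M c (\<lambda>p. J p (X p)))"
    by (rule smooth_on_cong[rotated])
       (use c chart_homeomorphism(2) in \<open>auto simp: field_in_chart_map chart_inv_map from_to_coords\<close>)
qed

end

text \<open>The product rule with \<open>X x\<close> frozen in the first summand. For
  \<open>A\<close> the derivative of a map, that summand is a second derivative of the map, to which
  symmetry applies.\<close>

lemma has_derivative_linear_family:
  fixes A :: "'a::euclidean_space \<Rightarrow> 'e::euclidean_space \<Rightarrow> 'f::euclidean_space"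
  assumes "open S" "x \<in> S" and A: "\<And>a. smooth_on S (\<lambda>x. A x a)" "\<And>x. x \<in> S \<Longrightarrow> linear (A x)"
    and X: "smooth_on S X"
  shows "((\<lambda>y. A y (X y)) has_derivative
    (\<lambda>v. frechet_derivative (\<lambda>y. A y (X x)) (at x) v + A x (frechet_derivative X (at x) v))) (at x)"
proof -
  \<comment> \<open>The increment of \<open>X\<close> is expanded in the basis. Its coefficients
    vanish at \<open>x\<close>, so the derivatives of the maps \<open>A y b\<close> drop
    out.\<close>
  have "((\<lambda>y. A y (X x + (X y - X x))) has_derivative
    (\<lambda>v. frechet_derivative (\<lambda>y. A y (X x)) (at x) v + A x (frechet_derivative X (at x) v))) (at x)"
  proof (rule has_derivative_transform_within_open[OF _ assms(1,2)])
    let ?dX = "\<lambda>v b. frechet_derivative X (at x) v \<bullet> b"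
    have "((\<lambda>y. A y (X x) + (\<Sum>b\<in>Basis. ((X y - X x) \<bullet> b) *\<^sub>R A y b)) has_derivative
      (\<lambda>v. frechet_derivative (\<lambda>y. A y (X x)) (at x) v + (\<Sum>b\<in>Basis. 
         ((X x - X x) \<bullet> b) *\<^sub>R frechet_derivative (\<lambda>y. A y b) (at x) v + ?dX v b *\<^sub>R A x b))) (at x)"
      by (intro has_derivative_add has_derivative_sum has_derivative_scaleR has_derivative_inner_left
          smooth_on_has_derivative[OF A(1) assms(2)])
         (auto intro!: derivative_eq_intros smooth_on_has_derivative[OF X assms(2)])
    moreover have "(\<Sum>b\<in>Basis. ((X x - X x) \<bullet> b) *\<^sub>R frechet_derivative (\<lambda>y. A y b) (at x) v
        + ?dX v b *\<^sub>R A x b) = A x (frechet_derivative X (at x) v)" for v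
      by (simp add: euclidean_representation
          flip: linear_sum[OF A(2)[OF assms(2)]] linear_scale[OF A(2)[OF assms(2)]])
    ultimately show "((\<lambda>y. A y (X x) + (\<Sum>b\<in>Basis. ((X y - X x) \<bullet> b) *\<^sub>R A y b)) has_derivative
      (\<lambda>v. frechet_derivative (\<lambda>y. A y (X x)) (at x) v + A x (frechet_derivative X (at x) v))) (at x)"
      by simp
    fix y assume "y \<in> S"
    then show "A y (X x) + (\<Sum>b\<in>Basis. ((X y - X x) \<bullet> b) *\<^sub>R A y b) = A y (X x + (X y - X x))"
      using linear_sum[OF A(2)] linear_scale[OF A(2)] linear_add[OF A(2)]
      by (simp only: euclidean_representation flip: linear_sum[OF A(2)] linear_scale[OF A(2)])
  qed
  then show ?thesis by simp
qed

section \<open>The vertical distribution of a Riemannian submersion\<close>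

locale submersion =
  fixes M :: "('m::{t2_space,second_countable_topology}, 'e::euclidean_space) chart set"
    and g :: "'m \<Rightarrow> 'e \<Rightarrow> 'e \<Rightarrow> real"
    and B :: "('b::{t2_space,second_countable_topology}, 'f::euclidean_space) chart set"
    and h :: "'b \<Rightarrow> 'f \<Rightarrow> 'f \<Rightarrow> real"
    and F :: "'m \<Rightarrow> 'b"
  assumes riemannian_submersion: "riemannian_submersion M g B h F"
begin

sublocale manifold M
  using riemannian_submersion by unfold_locales (simp add: riemannian_submersion_def riemannian_manifold_def)

sublocale base: manifold B
  using riemannian_submersion by unfold_locales (simp add: riemannian_submersion_def riemannian_manifold_def)

section \<open>Coordinate expressions of the submersion and its differential\<close>

abbreviation rep :: "('m, 'e) chart \<Rightarrow> ('b, 'f) chart \<Rightarrow> 'e \<Rightarrow> 'f" where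
  "rep c d \<equiv> chart_map d \<circ> F \<circ> chart_inv c"

abbreviation rep_dom :: "('m, 'e) chart \<Rightarrow> ('b, 'f) chart \<Rightarrow> 'e set" where
  "rep_dom c d \<equiv> chart_map c ` (chart_dom c \<inter> F -` chart_dom d)"

lemma scalar_product: "scalar_product (g p)"
  using riemannian_submersion
  by unfold_locales (auto simp: riemannian_submersion_def riemannian_manifold_def riemannian_metric_def)

lemma smooth_rep: "c \<in> M \<Longrightarrow> d \<in> B \<Longrightarrow> smooth_on (rep_dom c d) (rep c d)"
  using riemannian_submersion by (simp add: riemannian_submersion_def smooth_map_def)

lemma open_rep_dom:
  assumes "c \<in> M" "d \<in> B"
  shows "open (rep_dom c d)"
proof -
  have "continuous_on UNIV F"
    using riemannian_submersion by (simp add: riemannian_submersion_def smooth_map_def)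
  then have "open (F -` chart_dom d)"
    using base.chart_homeomorphism(1)[OF assms(2)] by (simp add: open_vimage)
  then show ?thesis by (rule open_chart_image[OF assms(1)])
qed

text \<open>\<open>pushforward\<close> uses selected charts that are unrelated at neighbouring
  points. In fixed charts \<open>c\<close> and \<open>d\<close> it becomes a smooth family of linear
  maps, up to an invertible factor in the base.\<close>

lemma pushforward_coords:
  assumes "c \<in> M" "p \<in> chart_dom c" "d \<in> B" "F p \<in> chart_dom d"
  shows "pushforward M B F p v = chart_deriv d (chart_at B (F p)) (F p)
    (frechet_derivative (rep c d) (at (chart_map c p)) (to_coords M c p v))"
proof -
  let ?c = "chart_at M p" and ?d = "chart_at B (F p)"
  let ?A = "frechet_derivative (rep c d) (at (chart_map c p))"
  have "(rep c d has_derivative ?A) (at (chart_map c p))"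
    by (rule smooth_on_has_derivative[OF smooth_rep]) (use assms in auto)
  from has_derivative_chart_change[OF chart_at(1) assms(1) chart_at(2) assms(2) this]
  have "(rep ?c d has_derivative ?A \<circ> chart_deriv ?c c p) (at (chart_map ?c p))" .
  moreover have "(chart_map ?d \<circ> chart_inv d has_derivative chart_deriv d ?d (F p))
      (at (rep ?c d (chart_map ?c p)))"
    using base.chart_change_has_derivative[OF assms(3) base.chart_at(1) assms(4) base.chart_at(2)]
    by (simp add: chart_inv_map chart_at)
  ultimately have "((chart_map ?d \<circ> chart_inv d) \<circ> rep ?c d has_derivative
      chart_deriv d ?d (F p) \<circ> (?A \<circ> chart_deriv ?c c p)) (at (chart_map ?c p))"
    by (rule diff_chain_at)
  then have "(rep ?c ?d has_derivative
      chart_deriv d ?d (F p) \<circ> (?A \<circ> chart_deriv ?c c p)) (at (chart_map ?c p))"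
    by (rule has_derivative_transform_within_open[OF _ open_rep_dom[OF chart_at(1) assms(3)]])
       (use assms chart_at in \<open>auto simp: chart_inv_map base.chart_inv_map[OF assms(3)]\<close>)
  note frechet_derivative_at[OF this, symmetric]
  then show ?thesis
    by (simp add: pushforward_def to_coords_eq)
qed

lemma pushforward_eq: "pushforward M B F p = frechet_derivative
    (rep (chart_at M p) (chart_at B (F p))) (at (chart_map (chart_at M p) p))"
  by (auto simp: pushforward_def)

lemma linear_rep:
  assumes "c \<in> M" "d \<in> B" "x \<in> rep_dom c d"
  shows "linear (frechet_derivative (rep c d) (at x))"
  using has_derivative_linear smooth_on_has_derivative[OF smooth_rep] assms by blast

lemma linear_pushforward: "linear (pushforward M B F p)"
  unfolding pushforward_eq by (rule linear_rep) (use chart_at base.chart_at in auto)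

lemma surj_pushforward: "surj (pushforward M B F p)"
proof -
  have "dim (range (pushforward M B F p)) = DIM('f)"
    using riemannian_submersion by (simp add: riemannian_submersion_def)
  moreover have "subspace (range (pushforward M B F p))"
    using linear_pushforward by (simp add: linear_subspace_image)
  ultimately show ?thesis
    by (metis dim_eq_full span_eq_iff)
qed

text \<open>The change of chart in the base is injective and does not affect the kernel.\<close>

lemma vertical_coords_iff:
  assumes "c \<in> M" "p \<in> chart_dom c" "d \<in> B" "F p \<in> chart_dom d"
  shows "v \<in> vertical M B F p \<longleftrightarrow>
    frechet_derivative (rep c d) (at (chart_map c p)) (to_coords M c p v) = 0"
proof -
  let ?D = "chart_deriv d (chart_at B (F p)) (F p)"
  have "?D w = 0 \<longleftrightarrow> w = 0" for w
    using base.chart_deriv_inverse[OF assms(3) base.chart_at(1) assms(4) base.chart_at(2), of w]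
      linear_0[OF base.linear_chart_deriv[OF assms(3) base.chart_at(1) assms(4) base.chart_at(2)]]
      linear_0[OF base.linear_chart_deriv[OF base.chart_at(1) assms(3) base.chart_at(2) assms(4)]]
    by auto
  then show ?thesis
    by (simp add: vertical_def pushforward_coords[OF assms])
qed

lemma surj_rep:
  assumes "c \<in> M" "p \<in> chart_dom c" "d \<in> B" "F p \<in> chart_dom d"
  shows "surj (frechet_derivative (rep c d) (at (chart_map c p)))"
proof (rule surjI)
  fix w
  let ?D = "chart_deriv d (chart_at B (F p)) (F p)"
  \<comment> \<open>A preimage is found in the selected charts and then read in \<open>c\<close>;
    injectivity of \<open>?D\<close> transfers the equation back to \<open>d\<close>.\<close>
  let ?v = "to_coords M c p (inv (pushforward M B F p) (?D w))"
  have "?D (frechet_derivative (rep c d) (at (chart_map c p)) ?v) = ?D w"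
    by (simp add: surj_f_inv_f[OF surj_pushforward] flip: pushforward_coords[OF assms])
  then show "frechet_derivative (rep c d) (at (chart_map c p)) ?v = w"
    using base.chart_deriv_inverse[OF assms(3) base.chart_at(1) assms(4) base.chart_at(2)] by metis
qed

section \<open>Vertical and horizontal projections\<close>

lemma subspace_vertical: "subspace (vertical M B F p)"
  unfolding vertical_def
  using linear_subspace_kernel[OF linear_pushforward] .

lemma subspace_horizontal: "subspace (horizontal M g B F p)"
proof -
  interpret scalar_product "g p" by (rule scalar_product)
  show ?thesis
    unfolding subspace_def horizontal_def
    by (simp add: bilinear_lzero[OF bilinear] bilinear_ladd[OF bilinear] bilinear_lmul[OF bilinear])
qed

lemma vert_eqI:
  assumes "w \<in> vertical M B F p" "\<And>u. u \<in> vertical M B F p \<Longrightarrow> g p (X p - w) u = 0"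
  shows "vert M g B F X p = w"
  unfolding vert_def using scalar_product.orth_proj_eqI[OF scalar_product subspace_vertical] assms .

text \<open>\<open>vert\<close> rests on a definite description, so a projection must first be shown
  to exist. It does because the vertical space is the kernel of a surjective linear map.\<close>

lemma vert_vertical: "vert M g B F X p \<in> vertical M B F p"
  and vert_orth: "u \<in> vertical M B F p \<Longrightarrow> g p (X p - vert M g B F X p) u = 0"
proof -
  obtain w where "pushforward M B F p w = 0"
      "\<And>u. pushforward M B F p u = 0 \<Longrightarrow> g p (X p - w) u = 0"
    by (rule kernel_projection_exists[OF scalar_product linear_pushforward surj_pushforward,
          of p p "X p"]) blast
  then have w: "w \<in> vertical M B F p" "\<And>u. u \<in> vertical M B F p \<Longrightarrow> g p (X p - w) u = 0"
    by (auto simp: vertical_def)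
  from vert_eqI[of w p X, OF w] w show "vert M g B F X p \<in> vertical M B F p"
    "u \<in> vertical M B F p \<Longrightarrow> g p (X p - vert M g B F X p) u = 0" by auto
qed

lemma vert_id: "X p \<in> vertical M B F p \<Longrightarrow> vert M g B F X p = X p"
  by (rule vert_eqI) (auto simp: bilinear_lzero[OF scalar_product.bilinear[OF scalar_product]])

lemma vert_add:
  "vert M g B F (\<lambda>p. X p + Y p) p = vert M g B F X p + vert M g B F Y p"
proof (rule vert_eqI)
  show "vert M g B F X p + vert M g B F Y p \<in> vertical M B F p"
    by (simp add: vert_vertical subspace_add subspace_vertical)
  fix u assume "u \<in> vertical M B F p"
  from vert_orth[OF this, of X] vert_orth[OF this, of Y]
  show "g p (X p + Y p - (vert M g B F X p + vert M g B F Y p)) u = 0"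
    using bilinear_ladd[OF scalar_product.bilinear[OF scalar_product]]
    by (simp add: add_diff_add)
qed

lemma vert_scale: "vert M g B F (\<lambda>p. a *\<^sub>R X p) p = a *\<^sub>R vert M g B F X p"
proof (rule vert_eqI)
  show "a *\<^sub>R vert M g B F X p \<in> vertical M B F p"
    by (simp add: vert_vertical subspace_scale subspace_vertical)
  fix u assume "u \<in> vertical M B F p"
  from vert_orth[OF this, of X]
  show "g p (a *\<^sub>R X p - a *\<^sub>R vert M g B F X p) u = 0"
    using bilinear_lmul[OF scalar_product.bilinear[OF scalar_product]]
    by (simp flip: scaleR_diff_right)
qed

lemma vert_diff:
  "vert M g B F (\<lambda>p. X p - Y p) p = vert M g B F X p - vert M g B F Y p"
  using vert_add[of X "\<lambda>p. -1 *\<^sub>R Y p" p] vert_scale[of "-1" Y p] by simp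

text \<open>Expresses horizontal projections through vertical ones, so that linearity and smoothness
  need treatment only for \<open>vert\<close>.\<close>

lemma horiz_eq: "horiz M g B F X p = X p - vert M g B F X p"
  unfolding horiz_def
proof (rule scalar_product.orth_proj_eqI[OF scalar_product subspace_horizontal])
  show "X p - vert M g B F X p \<in> horizontal M g B F p"
    by (simp add: horizontal_def vert_orth)
  fix u assume "u \<in> horizontal M g B F p"
  then show "g p (X p - (X p - vert M g B F X p)) u = 0"
    using vert_vertical[of X p] scalar_product.sym[OF scalar_product, of p "vert M g B F X p" u]
    by (simp add: horizontal_def)
qed

lemma vertical_field_coords:
  assumes "c \<in> M" "d \<in> B" "x \<in> rep_dom c d" "\<And>p. X p \<in> vertical M B F p"
  shows "frechet_derivative (rep c d) (at x) (field_in_chart M c X x) = 0"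
proof -
  obtain p where "p \<in> chart_dom c" "F p \<in> chart_dom d" "x = chart_map c p"
    using assms(3) by auto
  then show ?thesis
    using vertical_coords_iff[of c p d "X p"] assms(1,2,4)
    by (simp add: field_in_chart_map)
qed

section \<open>Smoothness of the vertical projection\<close>

text \<open>In charts the vertical part is the kernel projection for the differential of
  \<open>rep c d\<close>, taken with respect to the metric in coordinates.\<close>

lemma vector_fields_vert:
  assumes "X \<in> vector_fields M"
  shows "vert M g B F X \<in> vector_fields M"
  unfolding vector_fields_iff
proof
  fix c assume c: "c \<in> M"
  show "smooth_on (chart_map c ` chart_dom c) (field_in_chart M c (vert M g B F X))"
  proof (rule smooth_on_local)
    fix x assume "x \<in> chart_map c ` chart_dom c"
    then obtain p where p: "p \<in> chart_dom c" "x = chart_map c p" by auto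
    \<comment> \<open>A chart domain of \<open>M\<close> need not be mapped into one chart domain of
      \<open>B\<close>, so the argument is confined to the part that \<open>F\<close> sends into
      \<open>d\<close>.\<close>
    define d where "d = chart_at B (F p)"
    have d: "d \<in> B" "F p \<in> chart_dom d" by (simp_all add: d_def base.chart_at)
    let ?S = "rep_dom c d"
    have S: "open ?S" "?S \<subseteq> chart_map c ` chart_dom c" using open_rep_dom c d by auto
    let ?G = "\<lambda>x a b. let p = chart_inv c x in g p (from_coords M c p a) (from_coords M c p b)"
    have "smooth_on ?S (\<lambda>x. ?G x a b)" for a b
    proof (rule smooth_on_subset[OF _ S(2)])
      show "smooth_on (chart_map c ` chart_dom c) (\<lambda>x. ?G x a b)"
        using riemannian_submersion c
        by (auto simp: riemannian_submersion_def riemannian_manifold_def riemannian_metric_def)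
    qed
    moreover have "scalar_product (?G x)" if "x \<in> ?S" for x
    proof -
      from that obtain p where p: "p \<in> chart_dom c" "x = chart_map c p" by auto
      interpret scalar_product "g p" by (rule scalar_product)
      note lin = linear_from_coords[OF c p(1)]
      show ?thesis
      proof
        show "bilinear (?G x)"
          using linear_compose[OF lin linear_left] linear_compose[OF lin linear_right]
          by (simp add: bilinear_def p chart_inv_map c o_def)
        show "?G x v w = ?G x w v" for v w
          using sym by (simp add: p chart_inv_map c)
        show "?G x v v > 0" if "v \<noteq> 0" for v
          using pos[of "from_coords M c p v"] that to_from_coords[OF c p(1), of v]
            linear_0[OF linear_to_coords[OF c p(1)]]
          by (metis (no_types, lifting) c chart_inv_map p)
      qed
    qed
    moreover have "smooth_on ?S (\<lambda>x. frechet_derivative (rep c d) (at x) a)" for a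
      using smooth_on_frechet_derivative[OF smooth_rep] c d by blast
    moreover have "linear (frechet_derivative (rep c d) (at x))" if "x \<in> ?S" for x
      using linear_rep c d that by blast
    moreover have "surj (frechet_derivative (rep c d) (at x))" if "x \<in> ?S" for x
      using surj_rep c d that by blast
    moreover have "smooth_on ?S (field_in_chart M c X)"
      using assms c by (auto simp: vector_fields_iff intro: smooth_on_subset[OF _ S(2)])
    ultimately obtain Y where Y: "smooth_on ?S Y"
      "\<And>x. x \<in> ?S \<Longrightarrow> frechet_derivative (rep c d) (at x) (Y x) = 0"
      "\<And>x u. x \<in> ?S \<Longrightarrow> frechet_derivative (rep c d) (at x) u = 0 \<Longrightarrow>
        ?G x (field_in_chart M c X x - Y x) u = 0"
      by (rule smooth_kernel_projection[OF S(1), of ?G "\<lambda>x. frechet_derivative (rep c d) (at x)"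
          "field_in_chart M c X"]) blast+
    have "smooth_on ?S (field_in_chart M c (vert M g B F X))"
    proof (rule smooth_on_cong[OF S(1) Y(1)])
      fix x assume x: "x \<in> ?S"
      then obtain p where p: "p \<in> chart_dom c" "F p \<in> chart_dom d" "x = chart_map c p" by auto
      note coords = to_from_coords[OF c p(1)] from_to_coords[OF c p(1)]
      \<comment> \<open>Verticality and orthogonality of the residual characterise the projection,
        which identifies the smooth \<open>Y\<close> with it.\<close>
      have "vert M g B F X p = from_coords M c p (Y x)"
      proof (rule vert_eqI)
        show "from_coords M c p (Y x) \<in> vertical M B F p"
          using Y(2)[OF x] vertical_coords_iff[OF c p(1) d(1) p(2)] coords p by simp
        fix u assume "u \<in> vertical M B F p"
        then have "?G x (field_in_chart M c X x - Y x) (to_coords M c p u) = 0"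
          using vertical_coords_iff[OF c p(1) d(1) p(2)] p by (intro Y(3)[OF x]) simp
        then show "g p (X p - from_coords M c p (Y x)) u = 0"
          using p c coords linear_diff[OF linear_from_coords[OF c p(1)]]
          by (simp add: chart_inv_map field_in_chart_map)
      qed
      then show "Y x = field_in_chart M c (vert M g B F X) x"
        using p c coords by (simp add: field_in_chart_map)
    qed
    then show "\<exists>T. open T \<and> x \<in> T \<and> smooth_on T (field_in_chart M c (vert M g B F X))"
      using S(1) p d by blast
  qed
qed

text \<open>
  In charts a vertical field satisfies \<open>dF \<cdot> X = 0\<close> near the point; differentiating this along
  the other field and antisymmetrising leaves \<open>dF \<cdot> [X, Y] = 0\<close>, by symmetry of the second
  derivative.
\<close>

lemma lie_bracket_vertical:
  assumes X: "X \<in> vector_fields M" "\<And>p. X p \<in> vertical M B F p"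
    and Y: "Y \<in> vector_fields M" "\<And>p. Y p \<in> vertical M B F p"
  shows "lie_bracket M X Y p \<in> vertical M B F p"
proof -
  \<comment> \<open>Both the bracket and the pushforward at \<open>p\<close> are defined through
    these selected charts, where moreover each field has its own value at \<open>p\<close> as
    components.\<close>
  define c d x where "c = chart_at M p" and "d = chart_at B (F p)" and "x = chart_map c p"
  have c: "c \<in> M" "p \<in> chart_dom c" and d: "d \<in> B" "F p \<in> chart_dom d"
    by (simp_all add: c_def d_def chart_at base.chart_at)
  let ?S = "rep_dom c d"
  have S: "open ?S" "?S \<subseteq> chart_map c ` chart_dom c" "x \<in> ?S"
    using open_rep_dom c d by (auto simp: x_def)
  let ?A = "\<lambda>y. frechet_derivative (rep c d) (at y)"
  have lin: "linear (?A x)" using linear_rep c d S(3) by blast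
  have diff0: "frechet_derivative (\<lambda>y. ?A y (field_in_chart M c Z x)) (at x) v
      + ?A x (frechet_derivative (field_in_chart M c Z) (at x) v) = 0"
    if Z: "Z \<in> vector_fields M" "\<And>p. Z p \<in> vertical M B F p" for Z v
  proof -
    have "smooth_on ?S (field_in_chart M c Z)"
      using Z(1) c by (auto simp: vector_fields_iff intro: smooth_on_subset[OF _ S(2)])
    note D = has_derivative_linear_family[of ?S x ?A, OF S(1,3) _ _ this]
    have "((\<lambda>y. ?A y (field_in_chart M c Z y)) has_derivative (\<lambda>v.
        frechet_derivative (\<lambda>y. ?A y (field_in_chart M c Z x)) (at x) v
        + ?A x (frechet_derivative (field_in_chart M c Z) (at x) v))) (at x)"
      using smooth_on_frechet_derivative[OF smooth_rep[OF c(1) d(1)]] linear_rep[OF c(1) d(1)]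
      by (intro D) auto
    moreover have "((\<lambda>y. ?A y (field_in_chart M c Z y)) has_derivative (\<lambda>v. 0)) (at x)"
      by (rule has_derivative_transform_within_open[OF has_derivative_const S(1,3)])
         (use vertical_field_coords[OF c(1) d(1) _ Z(2)] in simp)
    ultimately have "(\<lambda>v. frechet_derivative (\<lambda>y. ?A y (field_in_chart M c Z x)) (at x) v
        + ?A x (frechet_derivative (field_in_chart M c Z) (at x) v)) = (\<lambda>v. 0)"
      by (rule has_derivative_unique)
    then show ?thesis by (rule fun_cong)
  qed
  have at_p: "field_in_chart M c Z x = Z p" for Z
    using field_in_chart_map[OF c] to_coords_chart_at by (simp add: c_def x_def)
  have "frechet_derivative (\<lambda>y. ?A y (Y p)) (at x) (X p)
      = frechet_derivative (\<lambda>y. ?A y (X p)) (at x) (Y p)"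
    by (rule symmetric_second_derivative[OF S(1,3) smooth_rep[OF c(1) d(1)]])
  with diff0[OF Y, of "X p"] diff0[OF X, of "Y p"]
  have "?A x (frechet_derivative (field_in_chart M c Y) (at x) (X p)
      - frechet_derivative (field_in_chart M c X) (at x) (Y p)) = 0"
    by (simp add: at_p linear_diff[OF lin]) (metis add_left_cancel)
  then show ?thesis
    by (simp add: vertical_def pushforward_eq lie_bracket_def Let_def c_def d_def x_def)
qed

end

section \<open>Generic submersions\<close>

text \<open>The pointwise algebra of the equivalence, to be applied with the Lie bracket as
  \<open>W\<close>: both sides say that the component of \<open>W p\<close> in \<open>D p\<close>
  vanishes.\<close>

lemma vert_complement_iff:
  assumes gen: "generic_riemannian_submersion M g J B h F D"
    and ah: "almost_hermitian_manifold M g J" and W: "W p \<in> vertical M B F p"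
  shows "vert M g B F (\<lambda>p. J p (W p)) p \<in> vertical_complement M g B F D p
    \<longleftrightarrow> W p \<in> vertical_complement M g B F D p"
proof -
  let ?E = "vertical_complement M g B F D p"
  interpret submersion M g B h F
    using gen by unfold_locales (simp add: generic_riemannian_submersion_def)
  interpret G: scalar_product "g p" by (rule scalar_product)
  have D: "D p \<subseteq> vertical M B F p" "D p \<inter> ?E = {0}" "J p ` D p = D p"
      "vertical M B F p = {u + v | u v. u \<in> D p \<and> v \<in> ?E}"
    using gen unfolding generic_riemannian_submersion_def by blast+
  have J: "linear (J p)" "\<And>v. J p (J p v) = - v" "\<And>v w. g p (J p v) (J p w) = g p v w"
    using ah by (auto simp: almost_hermitian_manifold_def almost_complex_structure_def)
  have E: "subspace ?E"
    unfolding vertical_complement_def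
    using subspace_vertical[of p]
    by (auto simp: subspace_def bilinear_lzero[OF G.bilinear] bilinear_ladd[OF G.bilinear]
        bilinear_lmul[OF G.bilinear])
  obtain u v where uv: "W p = u + v" "u \<in> D p" "v \<in> ?E"
    using W D(4) by blast
  have Ju: "J p u \<in> D p" using uv D(3) by blast
  let ?v = "vert M g B F (\<lambda>p. J p v) p"
  have "?v \<in> ?E"
    unfolding vertical_complement_def
  proof (intro CollectI conjI ballI vert_vertical)
    fix w assume w: "w \<in> D p"
    \<comment> \<open>\<open>J\<close> is skew for the metric and maps \<open>D\<close> into itself,
      so \<open>J v\<close> is orthogonal to \<open>D\<close>, and its vertical part inherits
      this.\<close>
    have "g p (J p v) w = - g p v (J p w)"
      using J(3)[of v "J p w"] J(2)[of w] bilinear_rneg[OF G.bilinear, of "J p v" w] by simp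
    moreover have "g p v (J p w) = 0"
      using uv(3) w D(3) by (auto simp: vertical_complement_def)
    moreover have "g p (J p v - ?v) w = 0"
      using vert_orth[of w p "\<lambda>p. J p v"] w D(1) by blast
    ultimately show "g p ?v w = 0"
      by (simp add: bilinear_lsub[OF G.bilinear])
  qed
  moreover have "vert M g B F (\<lambda>p. J p (W p)) p = J p u + ?v"
  proof -
    \<comment> \<open>Only the value at \<open>p\<close> matters to \<open>vert\<close>, so the
      field may be replaced by a constant function and split there.\<close>
    have "vert M g B F (\<lambda>p. J p (W p)) p = vert M g B F (\<lambda>q. J p u + J p v) p"
      by (simp add: vert_def uv(1) linear_add[OF J(1)])
    also have "\<dots> = vert M g B F (\<lambda>q. J p u) p + vert M g B F (\<lambda>q. J p v) p"
      by (rule vert_add)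
    also have "vert M g B F (\<lambda>q. J p u) p = J p u"
      using vert_id[of "\<lambda>q. J p u" p] Ju D(1) by blast
    finally show ?thesis by (simp add: vert_def)
  qed
  ultimately have "vert M g B F (\<lambda>p. J p (W p)) p \<in> ?E \<longleftrightarrow> J p u \<in> ?E"
    using E subspace_add[OF E, of "J p u" ?v] subspace_diff[OF E, of "J p u + ?v" ?v] by auto
  also have "\<dots> \<longleftrightarrow> J p u = 0" using Ju D(2) subspace_0[OF E] by auto
  also have "\<dots> \<longleftrightarrow> u = 0" using J(1,2) by (metis linear_0 neg_equal_0_iff_equal)
  also have "\<dots> \<longleftrightarrow> u \<in> ?E" using uv D(2) subspace_0[OF E] by auto
  also have "\<dots> \<longleftrightarrow> W p \<in> ?E"
    using E uv subspace_add[OF E, of u v] subspace_diff[OF E, of "u + v" v] by auto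
  finally show ?thesis .
qed

text \<open>By the nearly Kaehler identity the two derivatives of \<open>J\<close> differ by
  \<open>2 (nabla_U J) V\<close>, whose vertical part the last term removes. Torsion-freeness turns
  what remains into the bracket.\<close>

lemma vert_J_lie_bracket:
  assumes "submersion M g B h F" and nk: "nearly_kaehler M g J nab"
    and U: "U \<in> vector_fields M" "\<And>p. U p \<in> vertical M B F p"
    and V: "V \<in> vector_fields M" "\<And>p. V p \<in> vertical M B F p"
  shows "vert M g B F (nab U (phi M g J B F V)) p - vert M g B F (nab V (phi M g J B F U)) p
    + oneill_T M g B F nab U (omega M g J B F V) p - oneill_T M g B F nab V (omega M g J B F U) p
    - 2 *\<^sub>R Q_tensor M g J B F nab U V p
    = vert M g B F (\<lambda>p. J p (lie_bracket M U V p)) p"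
proof -
  interpret submersion M g B h F by (rule assms)
  note nk = nk[unfolded nearly_kaehler_def almost_hermitian_manifold_def]
  have lc: "levi_civita_connection M g nab" and acs: "almost_complex_structure M J" using nk by auto
  then have J: "\<And>p. linear (J p)" by (simp add: almost_complex_structure_def)
  have nab_add: "nab X (\<lambda>q. Y q + Z q) p = nab X Y p + nab X Z p"
    if "X \<in> vector_fields M" "Y \<in> vector_fields M" "Z \<in> vector_fields M" for X Y Z p
    using lc that by (simp add: levi_civita_connection_def affine_connection_def)
  \<comment> \<open>Needed for the first summand of \<open>oneill_T\<close>: the vertical part of a
    field \<open>omega Z\<close> is zero, so the connection is applied to the zero field
    there.\<close>
  have nab_0: "nab X (\<lambda>q. 0) p = 0" if "X \<in> vector_fields M" for X p
    using nab_add[OF that vector_fields_zero vector_fields_zero] by simp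
  have split: "vert M g B F (nab X (phi M g J B F Z)) p + oneill_T M g B F nab X (omega M g J B F Z) p
      = vert M g B F (\<lambda>p. nabla_J nab J X Z p + J p (nab X Z p)) p"
    if X: "X \<in> vector_fields M" "\<And>p. X p \<in> vertical M B F p" and Z: "Z \<in> vector_fields M" for X Z
  proof -
    let ?JZ = "\<lambda>p. J p (Z p)"
    have JZ: "?JZ \<in> vector_fields M"
      by (rule vector_fields_complex_structure[OF acs Z])
    have phi: "phi M g J B F Z = vert M g B F ?JZ"
      by (simp add: phi_def)
    have omega: "omega M g J B F Z = (\<lambda>p. ?JZ p - vert M g B F ?JZ p)"
      by (auto simp: omega_def horiz_eq)
    have v_omega: "vert M g B F (omega M g J B F Z) = (\<lambda>p. 0)"
      by (auto simp: omega vert_diff vert_id vert_vertical)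
    have vX: "vert M g B F X = X" using vert_id X(2) by blast
    have h_omega: "horiz M g B F (omega M g J B F Z) = omega M g J B F Z"
      by (rule ext) (simp add: horiz_eq v_omega)
    have "horiz M g B F (nab X (\<lambda>p. 0)) p = 0"
      using nab_0[OF X(1)] vert_id[of "nab X (\<lambda>p. 0)" p] subspace_0[OF subspace_vertical]
      by (simp add: horiz_eq)
    then have T: "oneill_T M g B F nab X (omega M g J B F Z) p
        = vert M g B F (nab X (omega M g J B F Z)) p"
      by (simp add: oneill_T_def vX v_omega h_omega)
    \<comment> \<open>The connection is additive on smooth fields; this is where smoothness of the
      vertical projection enters.\<close>
    have "omega M g J B F Z \<in> vector_fields M" "phi M g J B F Z \<in> vector_fields M"
      unfolding omega phi by (intro vector_fields_diff vector_fields_vert JZ)+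
    then have "nab X (\<lambda>q. phi M g J B F Z q + omega M g J B F Z q) p
        = nab X (phi M g J B F Z) p + nab X (omega M g J B F Z) p" for p
      by (intro nab_add X)
    then have "nab X ?JZ p = nab X (phi M g J B F Z) p + nab X (omega M g J B F Z) p" for p
      by (simp add: phi omega)
    then show ?thesis
      unfolding T by (simp add: nabla_J_def vert_add)
  qed
  have Q: "nabla_J nab J V U q = - nabla_J nab J U V q" for q
    using nk U V by (simp add: eq_neg_iff_add_eq_0 add.commute)
  have bracket: "J q (nab U V q) - J q (nab V U q) = J q (lie_bracket M U V q)" for q
    using lc U V by (simp add: levi_civita_connection_def flip: linear_diff[OF J])
  let ?N = "nabla_J nab J U V"
  have "vert M g B F (nab U (phi M g J B F V)) p - vert M g B F (nab V (phi M g J B F U)) p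
    + oneill_T M g B F nab U (omega M g J B F V) p - oneill_T M g B F nab V (omega M g J B F U) p
    - 2 *\<^sub>R Q_tensor M g J B F nab U V p
    = vert M g B F (\<lambda>p. ?N p + J p (nab U V p)) p
    - vert M g B F (\<lambda>p. nabla_J nab J V U p + J p (nab V U p)) p
    - vert M g B F (\<lambda>p. 2 *\<^sub>R ?N p) p"
    unfolding vert_scale split[OF U V(1), symmetric] split[OF V U(1), symmetric] Q_tensor_def
    by (simp add: algebra_simps)
  also have "\<dots> = vert M g B F (\<lambda>p. (?N p + J p (nab U V p))
      - (nabla_J nab J V U p + J p (nab V U p)) - 2 *\<^sub>R ?N p) p"
    by (simp only: vert_diff)
  also have "\<dots> = vert M g B F (\<lambda>p. J p (lie_bracket M U V p)) p"
    by (simp add: Q bracket[symmetric] scaleR_2)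
  finally show ?thesis .
qed

theorem corollary3p9:
  fixes M :: "('m::{t2_space,second_countable_topology}, 'e::euclidean_space) chart set"
    and B :: "('b::{t2_space,second_countable_topology}, 'f::euclidean_space) chart set"
    and gM :: "'m \<Rightarrow> 'e \<Rightarrow> 'e \<Rightarrow> real"
    and gB :: "'b \<Rightarrow> 'f \<Rightarrow> 'f \<Rightarrow> real"
    and J :: "'m \<Rightarrow> 'e \<Rightarrow> 'e"
    and nab :: "('m \<Rightarrow> 'e) \<Rightarrow> ('m \<Rightarrow> 'e) \<Rightarrow> 'm \<Rightarrow> 'e"
    and F :: "'m \<Rightarrow> 'b"
    and D Dperp :: "'m \<Rightarrow> 'e set"
  defines "Dperp \<equiv> vertical_complement M gM B F D"
  assumes "nearly_kaehler M gM J nab"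
    and "riemannian_manifold B gB"
    and "generic_riemannian_submersion M gM J B gB F D"
    and "surj F"
  shows "integrable_distribution M Dperp \<longleftrightarrow>
    (\<forall>U\<in>sections M Dperp. \<forall>V\<in>sections M Dperp.
      (\<lambda>p. vert M gM B F (nab U (phi M gM J B F V)) p
         - vert M gM B F (nab V (phi M gM J B F U)) p
         + oneill_T M gM B F nab U (omega M gM J B F V) p
         - oneill_T M gM B F nab V (omega M gM J B F U) p
         - 2 *\<^sub>R Q_tensor M gM J B F nab U V p) \<in> sections M Dperp)"
proof -
  interpret submersion M gM B gB F
    using assms(4) by unfold_locales (simp add: generic_riemannian_submersion_def)
  note nk = assms(2)[unfolded nearly_kaehler_def]
  have ah: "almost_hermitian_manifold M gM J"
    and acs: "almost_complex_structure M J" and lc: "levi_civita_connection M gM nab"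
    using nk by (auto simp: almost_hermitian_manifold_def)
  have "(\<lambda>p. vert M gM B F (nab U (phi M gM J B F V)) p
         - vert M gM B F (nab V (phi M gM J B F U)) p
         + oneill_T M gM B F nab U (omega M gM J B F V) p
         - oneill_T M gM B F nab V (omega M gM J B F U) p
         - 2 *\<^sub>R Q_tensor M gM J B F nab U V p) \<in> sections M Dperp
      \<longleftrightarrow> lie_bracket M U V \<in> sections M Dperp" (is "?E \<in> _ \<longleftrightarrow> _")
    if "U \<in> sections M Dperp" "V \<in> sections M Dperp" for U V
  proof -
    have U: "U \<in> vector_fields M" "U p \<in> vertical M B F p"
      and V: "V \<in> vector_fields M" "V p \<in> vertical M B F p" for p
      using that by (auto simp: sections_def Dperp_def vertical_complement_def)
    have E: "?E = vert M gM B F (\<lambda>p. J p (lie_bracket M U V p))"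
      using vert_J_lie_bracket[OF submersion_axioms assms(2) U V] by blast
    \<comment> \<open>Smoothness of the bracket comes from the connection, which preserves smooth
      fields and is torsion-free.\<close>
    have "(\<lambda>p. nab U V p - nab V U p) \<in> vector_fields M"
      using lc U V by (intro vector_fields_diff)
        (auto simp: levi_civita_connection_def affine_connection_def)
    then have smooth: "lie_bracket M U V \<in> vector_fields M"
      using lc U V by (simp add: levi_civita_connection_def)
    then have "?E \<in> vector_fields M"
      unfolding E by (intro vector_fields_vert vector_fields_complex_structure[OF acs])
    \<comment> \<open>With both fields known to be smooth, being a section is a pointwise
      condition.\<close>
    moreover have "?E p \<in> Dperp p \<longleftrightarrow> lie_bracket M U V p \<in> Dperp p" for p
      using vert_complement_iff[OF assms(4) ah, where W="lie_bracket M U V",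
          OF lie_bracket_vertical[OF U V], of p]
      by (simp only: Dperp_def vert_J_lie_bracket[OF submersion_axioms assms(2) U V])
    ultimately show ?thesis
      using smooth by (simp add: sections_def)
  qed
  then show ?thesis
    unfolding integrable_distribution_def by blast
qed

end
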